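(* Let $l\ge2$ be an integer and let $L_{rel}$ be a first-order language with relational vocabulary $\{R_1,\ldots,R_\rho\}$, $\rho>0$, where each $R_k$ has arity $r_k\ge2$. Suppose that every relation symbol has arity $\le l$. For every $I\subseteq\{1,\ldots,\rho\}$ the following hold: (i) There is an $L_{rel}$-formula $\xi(x,y)$ such that for almost all $\mathcal{M}\in\mathbf{S}^I$ the following holds: for every strong $l$-colouring $\gamma:M\to\{1,\ldots,l\}$ of $\mathcal{M}$ and all $a,b\in M$, $\gamma(a)=\gamma(b)$ if and only if $\mathcal{M}\models\xi(a,b)$. (ii) Almost all $\mathcal{M}\in\mathbf{S}^I$ are uniquely strongly $l$-colourable. (iii) $\mathbf{S}^I$ has a zero-one law.
   Context: A strong $l$-colouring of an $L_{rel}$-structure $\mathcal{M}$ is a function $\gamma:M\to\{1,\ldots,l\}$ such that for every $k$ and every $(a_1,\ldots,a_{r_k})\in R_k^{\mathcal{M}}$, $\gamma(a_i)\ne\gamma(a_j)$ whenever $i\neq j$. $\mathcal{M}$ is strongly $l$-colourable if it has a strong $l$-colouring, and uniquely strongly $l$-colourable if it is strongly $l$-colourable and for all strong $l$-colourings $\gamma,\gamma'$ of $\mathcal{M}$ and all $a,b\in M$, $\gamma(a)=\gamma(b)\Leftrightarrow\gamma'(a)=\gamma'(b)$. For $I\subseteq\{1,\ldots,\rho\}$, $\mathbf{S}^I_n$ is the set of strongly $l$-colourable $L_{rel}$-structures $\mathcal{M}$ with universe $\{1,\ldots,n\}$ such that for every $k\in I$, $R_k^{\mathcal{M}}$ is irreflexive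 (all entries of each tuple in it are distinct) and symmetric (closed under permuting the entries of tuples). $\mathbf{S}^I=\bigcup_{n\geq 1}\mathbf{S}^I_n$. "Almost all $\mathcal{M}\in\mathbf{S}^I$ have property $P$" means that the proportion of $\mathcal{M}\in\mathbf{S}^I_n$ with property $P$ approaches $1$ as $n\to\infty$. "$\mathbf{S}^I$ has a zero-one law" means that for every $L_{rel}$-sentence $\varphi$, either $\varphi$ or $\neg\varphi$ is satisfied by almost all $\mathcal{M}\in\mathbf{S}^I$. *)

theory Defs
  imports Complex_Main "HOL-Library.FuncSet" "HOL-Combinatorics.Permutations"
begin

text \<open>A relational vocabulary is given by a number \<open>\<rho>\<close> of relation symbols, indexed by \<open>{1..\<rho>}\<close>,
  and an arity function \<open>r\<close>, of which only the values on \<open>{1..\<rho>}\<close> matter.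
  Variables are natural numbers; equality belongs to the logic.\<close>

datatype fm =
    Rel nat "nat list"
  | Eq nat nat
  | Neg fm
  | Conj fm fm
  | Ex nat fm

fun formula :: "nat \<Rightarrow> (nat \<Rightarrow> nat) \<Rightarrow> fm \<Rightarrow> bool" where
  "formula \<rho> r (Rel k xs) \<longleftrightarrow> k \<in> {1..\<rho>} \<and> length xs = r k"
| "formula \<rho> r (Eq x y) \<longleftrightarrow> True"
| "formula \<rho> r (Neg \<phi>) \<longleftrightarrow> formula \<rho> r \<phi>"
| "formula \<rho> r (Conj \<phi> \<psi>) \<longleftrightarrow> formula \<rho> r \<phi> \<and> formula \<rho> r \<psi>"
| "formula \<rho> r (Ex x \<phi>) \<longleftrightarrow> formula \<rho> r \<phi>"

fun free_vars :: "fm \<Rightarrow> nat set" where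
  "free_vars (Rel k xs) = set xs"
| "free_vars (Eq x y) = {x, y}"
| "free_vars (Neg \<phi>) = free_vars \<phi>"
| "free_vars (Conj \<phi> \<psi>) = free_vars \<phi> \<union> free_vars \<psi>"
| "free_vars (Ex x \<phi>) = free_vars \<phi> - {x}"

definition sentence :: "nat \<Rightarrow> (nat \<Rightarrow> nat) \<Rightarrow> fm \<Rightarrow> bool" where
  "sentence \<rho> r \<phi> \<longleftrightarrow> formula \<rho> r \<phi> \<and> free_vars \<phi> = {}"

record 'a rel_struct =
  univ :: "'a set"
  rel :: "nat \<Rightarrow> 'a list set"

text \<open>Requiring \<open>rel M k = {}\<close> for indices outside the vocabulary makes a structure over a given
  vocabulary and universe correspond to exactly one value of the record type, so that
  counting these values counts structures.\<close>

definition L_structure :: "nat \<Rightarrow> (nat \<Rightarrow> nat) \<Rightarrow> 'a rel_struct \<Rightarrow> bool" where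
  "L_structure \<rho> r M \<longleftrightarrow>
     univ M \<noteq> {} \<and>
     (\<forall>k\<in>{1..\<rho>}. rel M k \<subseteq> {a. length a = r k \<and> set a \<subseteq> univ M}) \<and>
     (\<forall>k. k \<notin> {1..\<rho>} \<longrightarrow> rel M k = {})"

fun sat :: "'a rel_struct \<Rightarrow> (nat \<Rightarrow> 'a) \<Rightarrow> fm \<Rightarrow> bool" where
  "sat M v (Rel k xs) \<longleftrightarrow> map v xs \<in> rel M k"
| "sat M v (Eq x y) \<longleftrightarrow> v x = v y"
| "sat M v (Neg \<phi>) \<longleftrightarrow> \<not> sat M v \<phi>"
| "sat M v (Conj \<phi> \<psi>) \<longleftrightarrow> sat M v \<phi> \<and> sat M v \<psi>"
| "sat M v (Ex x \<phi>) \<longleftrightarrow> (\<exists>a\<in>univ M. sat M (v(x := a)) \<phi>)"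

definition models :: "'a rel_struct \<Rightarrow> fm \<Rightarrow> bool" where
  "models M \<phi> \<longleftrightarrow> (\<forall>v \<in> UNIV \<rightarrow> univ M. sat M v \<phi>)"

text \<open>Meant for formulas whose free variables are among 0 and 1, which are interpreted by
  \<open>a\<close> and \<open>b\<close> respectively; the value of the assignment elsewhere is then immaterial.\<close>

definition models_at :: "'a rel_struct \<Rightarrow> fm \<Rightarrow> 'a \<Rightarrow> 'a \<Rightarrow> bool" where
  "models_at M \<xi> a b \<longleftrightarrow> sat M ((\<lambda>_. a)(1 := b)) \<xi>"

definition strong_colouring :: "nat \<Rightarrow> 'a rel_struct \<Rightarrow> ('a \<Rightarrow> nat) \<Rightarrow> bool" where
  "strong_colouring l M \<gamma> \<longleftrightarrow>
     \<gamma> \<in> univ M \<rightarrow> {1..l} \<and>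
     (\<forall>k. \<forall>a\<in>rel M k. \<forall>i<length a. \<forall>j<length a. i \<noteq> j \<longrightarrow> \<gamma> (a ! i) \<noteq> \<gamma> (a ! j))"

definition strongly_colourable :: "nat \<Rightarrow> 'a rel_struct \<Rightarrow> bool" where
  "strongly_colourable l M \<longleftrightarrow> (\<exists>\<gamma>. strong_colouring l M \<gamma>)"

definition uniquely_strongly_colourable :: "nat \<Rightarrow> 'a rel_struct \<Rightarrow> bool" where
  "uniquely_strongly_colourable l M \<longleftrightarrow>
     strongly_colourable l M \<and>
     (\<forall>\<gamma> \<gamma>'. strong_colouring l M \<gamma> \<longrightarrow> strong_colouring l M \<gamma>' \<longrightarrow>
       (\<forall>a\<in>univ M. \<forall>b\<in>univ M. \<gamma> a = \<gamma> b \<longleftrightarrow> \<gamma>' a = \<gamma>' b))"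

definition irreflexive_rel :: "'a list set \<Rightarrow> bool" where
  "irreflexive_rel R \<longleftrightarrow> (\<forall>a\<in>R. distinct a)"

definition symmetric_rel :: "'a list set \<Rightarrow> bool" where
  "symmetric_rel R \<longleftrightarrow> (\<forall>a\<in>R. \<forall>\<sigma>. \<sigma> permutes {..<length a} \<longrightarrow> permute_list \<sigma> a \<in> R)"

definition S_class :: "nat \<Rightarrow> (nat \<Rightarrow> nat) \<Rightarrow> nat \<Rightarrow> nat set \<Rightarrow> nat \<Rightarrow> nat rel_struct set" where
  "S_class \<rho> r l I n =
     {M. L_structure \<rho> r M \<and> univ M = {1..n} \<and> strongly_colourable l M \<and>
         (\<forall>k\<in>I. irreflexive_rel (rel M k) \<and> symmetric_rel (rel M k))}"

definition almost_all :: "(nat \<Rightarrow> 'm set) \<Rightarrow> ('m \<Rightarrow> bool) \<Rightarrow> bool" where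
  "almost_all S P \<longleftrightarrow>
     (\<lambda>n. real (card {M \<in> S n. P M}) / real (card (S n))) \<longlonglongrightarrow> 1"

definition zero_one_law :: "nat \<Rightarrow> (nat \<Rightarrow> nat) \<Rightarrow> (nat \<Rightarrow> 'a rel_struct set) \<Rightarrow> bool" where
  "zero_one_law \<rho> r S \<longleftrightarrow>
     (\<forall>\<phi>. sentence \<rho> r \<phi> \<longrightarrow>
        almost_all S (\<lambda>M. models M \<phi>) \<or> almost_all S (\<lambda>M. models M (Neg \<phi>)))"

end

theory Submission
  imports Defs "HOL-Combinatorics.Multiset_Permutations" "HOL-Real_Asymp.Real_Asymp"
begin

text \<open>The structures for which \<open>\<gamma>\<close> is a strong colouring correspond to the subsets of a finite set
  of slots, the tuples (or sets, for the symmetric relations) with pairwise distinct colours.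
  Count pairs of a colouring and a structure. Moving one vertex from a colour class of size at
  least \<open>n / l\<close> to one of size less than \<open>n / (4 l)\<close> gains at least \<open>n / (2 l)\<close> slots unless there
  are none, so colourings with a small class carry a vanishing proportion of the pairs; colourings
  without slots miss a colour and are a vanishing proportion of all colourings. For the remaining
  colourings a union bound shows that almost every structure has all coloured one-point
  extensions over fewer than \<open>t\<close> vertices. These extensions produce cliques which force any strong
  colouring to induce the given partition, so a structure occurs in boundedly many pairs and
  counting pairs amounts to counting structures; the same cliques define the partition. Finally,
  any two structures with the extension property agree, by back-and-forth, on all sentences of
  size at most \<open>t\<close>.\<close>

text \<open>Structures are counted together with a colouring because uniqueness of the colouring
  only becomes available for structures that already have the extension property. Moving a vertex
  from a class of size \<open>b\<close> to one of size \<open>a\<close> keeps \<open>a + b\<close>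
  and turns \<open>a * b\<close> into \<open>(a + 1) * (b - 1)\<close>, so each gain is
  \<open>b - a - 1\<close> times a number of smaller rainbow sets. That number is positive for some
  relation once there is a slot, since forbidding two colours costs a rainbow set at most two
  members. A gain linear in \<open>n\<close> multiplies the number of structures by an exponential,
  while at most \<open>n * l\<close> colourings share a modification. Crude estimates therefore
  suffice, and the threshold \<open>n / (4 l)\<close> only has to stay a fixed fraction below the
  average \<open>n / l\<close>. Linear class sizes in turn set exponentially small failure
  probabilities against polynomially many demands. The bound of the arities by \<open>l\<close>
  ensures that a colouring with all colours has a slot, and that a set of \<open>l\<close> vertices
  with distinct colours can contain a tuple of the first relation.\<close>

section \<open>An independence estimate\<close>

text \<open>For a random subset \<open>W\<close> of \<open>S\<close> the traces on the disjoint
  blocks \<open>P b\<close> are independent, and each misses its target \<open>T b\<close> with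
  probability at most \<open>1 - 1 / 2 ^ m\<close>. The induction peels off one block, on which
  every trace but \<open>T b\<close> is left.\<close>

lemma card_avoid_le:
  assumes "finite B" "finite S"
    and "\<And>b. b \<in> B \<Longrightarrow> P b \<subseteq> S" "\<And>b. b \<in> B \<Longrightarrow> card (P b) \<le> m"
    and "\<And>b. b \<in> B \<Longrightarrow> T b \<subseteq> P b"
    and "\<And>b b'. b \<in> B \<Longrightarrow> b' \<in> B \<Longrightarrow> b \<noteq> b' \<Longrightarrow> P b \<inter> P b' = {}"
  shows "real (card {W. W \<subseteq> S \<and> (\<forall>b\<in>B. W \<inter> P b \<noteq> T b)})
    \<le> 2 ^ card S * (1 - 1 / 2 ^ m) ^ card B"
  using assms
proof (induction B arbitrary: S)
  case empty
  have "{W. W \<subseteq> S \<and> (\<forall>b\<in>{}. W \<inter> P b \<noteq> T b)} = Pow S" by auto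
  then show ?case using empty by (simp add: card_Pow)
next
  case (insert b B)
  let ?S = "S - P b"
  let ?F = "\<lambda>S B. {W. W \<subseteq> S \<and> (\<forall>b\<in>B. W \<inter> P b \<noteq> T b)}"
  have fin: "finite (P b)" using insert.prems by (meson finite_subset insertI1)
  have disj: "P b' \<inter> P b = {}" if "b' \<in> B" for b'
    using insert.prems(5)[of b' b] insert.hyps that by auto
  have IH: "real (card (?F ?S B)) \<le> 2 ^ card ?S * (1 - 1 / 2 ^ m) ^ card B"
  proof (rule insert.IH)
    show "P b' \<subseteq> ?S" if "b' \<in> B" for b' using insert.prems(2)[of b'] disj[OF that] that by auto
  qed (use insert.prems in auto)
  have "card (?F S (insert b B)) \<le> card ((Pow (P b) - {T b}) \<times> ?F ?S B)"
  proof (rule card_inj_on_le[of "\<lambda>W. (W \<inter> P b, W - P b)"])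
    show "inj_on (\<lambda>W. (W \<inter> P b, W - P b)) (?F S (insert b B))"
      by (rule inj_onI) (metis Int_Diff_Un Pair_inject)
    have "(W - P b) \<inter> P b' = W \<inter> P b'" if "b' \<in> B" for W b' using disj[OF that] by auto
    then show "(\<lambda>W. (W \<inter> P b, W - P b)) ` ?F S (insert b B) \<subseteq> (Pow (P b) - {T b}) \<times> ?F ?S B"
      by auto
    show "finite ((Pow (P b) - {T b}) \<times> ?F ?S B)" using fin insert.prems(1) by auto
  qed
  also have "\<dots> = (2 ^ card (P b) - 1) * card (?F ?S B)"
    using insert.prems(4)[of b] fin by (simp add: card_cartesian_product card_Pow card_Diff_singleton)
  finally have "real (card (?F S (insert b B))) \<le> real ((2 ^ card (P b) - 1) * card (?F ?S B))"
    by (rule of_nat_mono)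
  also have "\<dots> = (2 ^ card (P b) - 1) * real (card (?F ?S B))" by (simp add: of_nat_diff)
  also have "\<dots> \<le> (2 ^ card (P b) - 1) * (2 ^ card ?S * (1 - 1 / 2 ^ m) ^ card B)"
    by (intro mult_left_mono IH) simp
  also have "\<dots> = (2 ^ card (P b) * 2 ^ card ?S) * (1 - 1 / 2 ^ card (P b)) * (1 - 1 / 2 ^ m) ^ card B"
    by (simp add: field_simps)
  also have "2 ^ card (P b) * 2 ^ card ?S = (2 ^ card S :: real)"
    using insert.prems(2)[of b] fin insert.prems(1)
    by (simp add: card_Diff_subset card_mono flip: power_add)
  also have "2 ^ card S * (1 - 1 / 2 ^ card (P b)) * (1 - 1 / 2 ^ m) ^ card B
      \<le> 2 ^ card S * (1 - 1 / 2 ^ m) * (1 - 1 / 2 ^ m :: real) ^ card B"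
    using insert.prems(3)[of b]
    by (intro mult_right_mono mult_left_mono diff_left_mono divide_left_mono power_increasing
      zero_le_power) auto
  finally show ?case using insert.hyps by (simp add: mult_ac)
qed

section \<open>Sets of vertices with pairwise distinct colours\<close>

text \<open>In terms of the sizes of the colour classes, the cardinality is the elementary symmetric
  polynomial of degree \<open>m\<close>; the following lemmas expand it in one and in two of its
  variables.\<close>

definition rsets :: "('a \<Rightarrow> 'b) \<Rightarrow> 'a set \<Rightarrow> nat \<Rightarrow> 'a set set" where
  "rsets \<gamma> V m = {A. A \<subseteq> V \<and> card A = m \<and> inj_on \<gamma> A}"

lemma finite_rsets: "finite V \<Longrightarrow> finite (rsets \<gamma> V m)"
  unfolding rsets_def by (rule finite_subset[of _ "Pow V"]) auto

lemma rsets_cong: "(\<And>x. x \<in> V \<Longrightarrow> \<gamma> x = \<gamma>' x) \<Longrightarrow> rsets \<gamma> V m = rsets \<gamma>' V m"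
  unfolding rsets_def by (intro Collect_cong conj_cong inj_on_cong refl) auto

text \<open>A set with distinct colours has at most one vertex of colour \<open>c\<close>: it either
  avoids \<open>X\<close>, or is a smaller such set in \<open>U\<close> with a free choice from
  \<open>X\<close> added.\<close>

lemma card_rsets_Un:
  assumes "finite U" "finite X" "\<And>x. x \<in> X \<Longrightarrow> \<gamma> x = c" "\<And>x. x \<in> U \<Longrightarrow> \<gamma> x \<noteq> c"
  shows "card (rsets \<gamma> (U \<union> X) (Suc m)) =
    card (rsets \<gamma> U (Suc m)) + card X * card (rsets \<gamma> U m)"
proof -
  let ?f = "\<lambda>(x, A). insert x A" and ?Z = "X \<times> rsets \<gamma> U m"
  have UX: "U \<inter> X = {}" using assms by auto
  have sub: "A \<in> rsets \<gamma> U (Suc m) \<union> ?f ` ?Z" if A: "A \<in> rsets \<gamma> (U \<union> X) (Suc m)" for A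
  proof (cases "A \<inter> X = {}")
    case True
    then show ?thesis using A by (auto simp: rsets_def)
  next
    case False
    then obtain x where x: "x \<in> A" "x \<in> X" by auto
    have eq: "y = x" if "y \<in> A" "y \<in> X" for y
    proof -
      have "inj_on \<gamma> A" using A by (simp add: rsets_def)
      moreover have "\<gamma> y = \<gamma> x" using that x assms(3) by simp
      ultimately show ?thesis using that x by (simp add: inj_on_eq_iff)
    qed
    have "A - {x} \<subseteq> U" using A eq unfolding rsets_def by blast
    then have "A - {x} \<in> rsets \<gamma> U m"
      using A x by (simp add: rsets_def inj_on_diff)
    then have "A \<in> ?f ` ?Z" using x by (intro image_eqI[of _ _ "(x, A - {x})"]) auto
    then show ?thesis by simp
  qed
  have sup: "insert x A \<in> rsets \<gamma> (U \<union> X) (Suc m)" if "x \<in> X" "A \<in> rsets \<gamma> U m" for x A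
  proof -
    have "finite A" using that(2) assms(1) by (auto simp: rsets_def intro: finite_subset)
    moreover have "x \<notin> A" using that UX by (auto simp: rsets_def)
    moreover have "\<gamma> x \<notin> \<gamma> ` A"
    proof
      assume "\<gamma> x \<in> \<gamma> ` A"
      then obtain y where "y \<in> A" "\<gamma> y = \<gamma> x" by auto
      moreover from this have "y \<in> U" using that(2) by (auto simp: rsets_def)
      ultimately show False using assms(3)[OF that(1)] assms(4)[of y] by simp
    qed
    ultimately show ?thesis using that by (auto simp: rsets_def)
  qed
  have "rsets \<gamma> (U \<union> X) (Suc m) = rsets \<gamma> U (Suc m) \<union> ?f ` ?Z"
  proof (intro equalityI Un_least)
    show "rsets \<gamma> (U \<union> X) (Suc m) \<subseteq> rsets \<gamma> U (Suc m) \<union> ?f ` ?Z"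
      by (rule subsetI) (rule sub)
    show "rsets \<gamma> U (Suc m) \<subseteq> rsets \<gamma> (U \<union> X) (Suc m)" by (auto simp: rsets_def)
    show "?f ` ?Z \<subseteq> rsets \<gamma> (U \<union> X) (Suc m)" using sup by (intro image_subsetI) auto
  qed
  moreover have "rsets \<gamma> U (Suc m) \<inter> ?f ` ?Z = {}" using UX by (auto simp: rsets_def)
  moreover have "inj_on ?f ?Z"
  proof (rule inj_onI, clarify)
    fix x A y B
    assume xy: "x \<in> X" "y \<in> X" "A \<in> rsets \<gamma> U m" "B \<in> rsets \<gamma> U m" "insert x A = insert y B"
    have "x \<notin> A" "x \<notin> B" "y \<notin> A" "y \<notin> B" using xy(1-4) UX by (auto simp: rsets_def)
    then show "x = y \<and> A = B" using xy(5) by (metis insertE insertI1 insert_ident)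
  qed
  ultimately show ?thesis using assms
    by (simp add: card_Un_disjoint finite_rsets card_image card_cartesian_product)
qed

lemma card_rsets_two_classes:
  fixes \<gamma> :: "'a \<Rightarrow> 'b"
  assumes "finite V" "i \<noteq> j"
  defines "W \<equiv> {x \<in> V. \<gamma> x \<noteq> i \<and> \<gamma> x \<noteq> j}"
  defines "a \<equiv> card {x \<in> V. \<gamma> x = i}" and "b \<equiv> card {x \<in> V. \<gamma> x = j}"
  shows "card (rsets \<gamma> V (Suc (Suc m))) = card (rsets \<gamma> W (Suc (Suc m)))
    + (a + b) * card (rsets \<gamma> W (Suc m)) + a * b * card (rsets \<gamma> W m)"
proof -
  let ?a = "{x \<in> V. \<gamma> x = i}" and ?b = "{x \<in> V. \<gamma> x = j}"
  have V: "V = (W \<union> ?a) \<union> ?b" unfolding W_def by auto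
  have 1: "card (rsets \<gamma> (W \<union> ?a) (Suc m)) = card (rsets \<gamma> W (Suc m)) + a * card (rsets \<gamma> W m)" for m
    unfolding a_def by (rule card_rsets_Un) (use assms(1) in \<open>auto simp: W_def\<close>)
  have "card (rsets \<gamma> ((W \<union> ?a) \<union> ?b) (Suc m)) =
      card (rsets \<gamma> (W \<union> ?a) (Suc m)) + b * card (rsets \<gamma> (W \<union> ?a) m)" for m
    unfolding b_def by (rule card_rsets_Un) (use assms(1,2) in \<open>auto simp: W_def\<close>)
  from this[folded V] show ?thesis by (simp add: 1 algebra_simps)
qed

text \<open>In the expansion by two classes, \<open>W\<close> and the sum of the two sizes are
  unaffected by the move, so only the product term changes. The identity is written with sums on
  both sides to avoid truncated subtraction.\<close>

lemma card_rsets_recolour: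
  fixes \<gamma> :: "'a \<Rightarrow> 'b"
  assumes "finite V" "i \<noteq> j" "v \<in> V" "\<gamma> v = j"
  defines "W \<equiv> {x \<in> V. \<gamma> x \<noteq> i \<and> \<gamma> x \<noteq> j}"
  shows "card (rsets (\<gamma>(v := i)) V (Suc (Suc m))) + Suc (card {x \<in> V. \<gamma> x = i}) * card (rsets \<gamma> W m)
    = card (rsets \<gamma> V (Suc (Suc m))) + card {x \<in> V. \<gamma> x = j} * card (rsets \<gamma> W m)"
proof -
  let ?g = "\<gamma>(v := i)"
  let ?a = "{x \<in> V. \<gamma> x = i}" and ?b = "{x \<in> V. \<gamma> x = j}"
  have "{x \<in> V. ?g x = i} = insert v ?a" "{x \<in> V. ?g x = j} = ?b - {v}"
    using assms by auto
  then have a: "card {x \<in> V. ?g x = i} = Suc (card ?a)" and b: "Suc (card {x \<in> V. ?g x = j}) = card ?b"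
    using assms by (simp_all add: card_Suc_Diff1 del: card_Diff_insert card_Diff_singleton)
  have W: "{x \<in> V. ?g x \<noteq> i \<and> ?g x \<noteq> j} = W" using assms by (auto simp: W_def)
  have g: "rsets ?g W k = rsets \<gamma> W k" for k
    by (rule rsets_cong) (use assms in \<open>auto simp: W_def\<close>)
  show ?thesis
    unfolding card_rsets_two_classes[OF assms(1,2), of ?g, unfolded W g a]
      card_rsets_two_classes[OF assms(1,2), of \<gamma>] W_def[symmetric] b[symmetric]
    by (simp add: algebra_simps)
qed

text \<open>Two forbidden colours remove at most two vertices from a set with distinct
  colours.\<close>

lemma rsets_avoid_nonempty:
  assumes "finite V" "rsets \<gamma> V (Suc (Suc m)) \<noteq> {}"
  shows "rsets \<gamma> {x \<in> V. \<gamma> x \<noteq> i \<and> \<gamma> x \<noteq> j} m \<noteq> {}"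
proof -
  obtain A where A: "A \<subseteq> V" "card A = Suc (Suc m)" "inj_on \<gamma> A"
    using assms(2) by (auto simp: rsets_def)
  have fin: "finite A" using A assms(1) finite_subset by auto
  let ?D = "{x \<in> A. \<gamma> x \<noteq> i \<and> \<gamma> x \<noteq> j}" and ?E = "{x \<in> A. \<gamma> x = i \<or> \<gamma> x = j}"
  have "card ?E \<le> card {i, j}"
    by (rule card_inj_on_le[of \<gamma>]) (auto intro!: inj_on_subset[OF A(3)])
  also have "\<dots> \<le> 2" by (simp add: card_insert_if)
  finally have "card ?E \<le> 2" .
  moreover have "card A = card ?D + card ?E"
  proof -
    have "card A = card (?D \<union> ?E)" by (rule arg_cong[of _ _ card]) auto
    also have "\<dots> = card ?D + card ?E" by (rule card_Un_disjoint) (use fin in auto)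
    finally show ?thesis .
  qed
  ultimately have "m \<le> card ?D" using A(2) by linarith
  then obtain B where B: "B \<subseteq> ?D" "card B = m"
    by (rule obtain_subset_with_card_n) blast
  moreover have "inj_on \<gamma> B" using A(3) by (rule inj_on_subset) (use B in blast)
  ultimately have "B \<in> rsets \<gamma> {x \<in> V. \<gamma> x \<noteq> i \<and> \<gamma> x \<noteq> j} m"
    using A(1) unfolding rsets_def by blast
  then show ?thesis by auto
qed

section \<open>Structures as sets of slots\<close>

locale vocabulary =
  fixes \<rho> l :: nat and r :: "nat \<Rightarrow> nat" and I :: "nat set"
  assumes two_le_l: "2 \<le> l" and rho_pos: "0 < \<rho>"
    and two_le_arity: "\<And>k. k \<in> {1..\<rho>} \<Longrightarrow> 2 \<le> r k"
    and arity_le_l: "\<And>k. k \<in> {1..\<rho>} \<Longrightarrow> r k \<le> l"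
begin

text \<open>A key stands for one independent yes-no decision. In a symmetric relation all orderings
  of a tuple stand or fall together, so only the set of entries is recorded.\<close>

definition key :: "nat \<Rightarrow> 'a list \<Rightarrow> nat \<times> ('a list + 'a set)" where
  "key k xs = (k, if k \<in> I then Inr (set xs) else Inl xs)"

definition kmap :: "('a \<Rightarrow> 'b) \<Rightarrow> nat \<times> ('a list + 'a set) \<Rightarrow> nat \<times> ('b list + 'b set)" where
  "kmap f = map_prod id (map_sum (map f) (image f))"

definition rainbow :: "('a \<Rightarrow> nat) \<Rightarrow> 'a set \<Rightarrow> nat \<Rightarrow> 'a list set" where
  "rainbow \<gamma> V k = {xs. length xs = r k \<and> set xs \<subseteq> V \<and> distinct (map \<gamma> xs)}"

definition slots :: "('a \<Rightarrow> nat) \<Rightarrow> 'a set \<Rightarrow> (nat \<times> ('a list + 'a set)) set" where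
  "slots \<gamma> V = (\<Union>k\<in>{1..\<rho>}. key k ` rainbow \<gamma> V k)"

text \<open>\<open>distinct\<close> is required because a set key forgets repetitions: a list with
  repeated entries would otherwise pass for a tuple with the same entries.\<close>

definition struc :: "'a set \<Rightarrow> (nat \<times> ('a list + 'a set)) set \<Rightarrow> 'a rel_struct" where
  "struc V W = \<lparr>univ = V, rel = \<lambda>k. {xs. distinct xs \<and> key k xs \<in> W}\<rparr>"

definition coloured_structures :: "('a \<Rightarrow> nat) \<Rightarrow> 'a set \<Rightarrow> 'a rel_struct set" where
  "coloured_structures \<gamma> V = {M. L_structure \<rho> r M \<and> univ M = V \<and> strong_colouring l M \<gamma> \<and>
     (\<forall>k\<in>I. irreflexive_rel (rel M k) \<and> symmetric_rel (rel M k))}"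

lemma univ_struc [simp]: "univ (struc V W) = V"
  and rel_struc [simp]: "rel (struc V W) k = {xs. distinct xs \<and> key k xs \<in> W}"
  by (simp_all add: struc_def)

lemma key_map: "key k (map f xs) = kmap f (key k xs)"
  by (simp add: key_def kmap_def)

lemma key_eqD:
  assumes "key k xs = key k' ys" "distinct xs" "distinct ys"
  shows "k = k'" "set xs = set ys" "length xs = length ys"
proof -
  show "k = k'" using assms(1) by (simp add: key_def)
  show eq: "set xs = set ys" using assms(1) by (auto simp: key_def split: if_splits)
  show "length xs = length ys" using eq assms(2,3) by (metis distinct_card)
qed

lemma rainbowD:
  assumes "xs \<in> rainbow \<gamma> V k"
  shows "distinct xs" "length xs = r k" "set xs \<subseteq> V" "inj_on \<gamma> (set xs)"
  using assms by (auto simp: rainbow_def distinct_map)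

lemma rainbowI:
  "distinct xs \<Longrightarrow> length xs = r k \<Longrightarrow> set xs \<subseteq> V \<Longrightarrow> inj_on \<gamma> (set xs) \<Longrightarrow> xs \<in> rainbow \<gamma> V k"
  by (auto simp: rainbow_def distinct_map)

lemma key_in_slots_iff:
  assumes "distinct xs"
  shows "key k xs \<in> slots \<gamma> V \<longleftrightarrow> k \<in> {1..\<rho>} \<and> xs \<in> rainbow \<gamma> V k"
proof
  assume "key k xs \<in> slots \<gamma> V"
  then obtain k' ys where ys: "k' \<in> {1..\<rho>}" "ys \<in> rainbow \<gamma> V k'" "key k xs = key k' ys"
    by (auto simp: slots_def)
  note e = key_eqD[OF ys(3) assms rainbowD(1)[OF ys(2)]]
  have "xs \<in> rainbow \<gamma> V k"
    using assms rainbowD[OF ys(2)] unfolding e(1)[symmetric] e(2,3)[symmetric]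
    by (intro rainbowI)
  then show "k \<in> {1..\<rho>} \<and> xs \<in> rainbow \<gamma> V k" using ys(1) e(1) by simp
qed (auto simp: slots_def)

lemma finite_rainbow: "finite V \<Longrightarrow> finite (rainbow \<gamma> V k)"
  by (rule finite_subset[OF _ finite_lists_length_eq[of V "r k"]]) (auto simp: rainbow_def)

lemma finite_slots: "finite V \<Longrightarrow> finite (slots \<gamma> V)"
  by (auto simp: slots_def finite_rainbow)

lemma rel_struc_subset_rainbow:
  assumes "W \<subseteq> slots \<gamma> V" "xs \<in> rel (struc V W) k"
  shows "k \<in> {1..\<rho>}" "xs \<in> rainbow \<gamma> V k"
  using assms key_in_slots_iff[of xs k \<gamma> V] by auto

lemma struc_in_coloured_structures:
  assumes "V \<noteq> {}" "\<gamma> \<in> V \<rightarrow> {1..l}" "W \<subseteq> slots \<gamma> V"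
  shows "struc V W \<in> coloured_structures \<gamma> V"
proof -
  let ?M = "struc V W"
  note R = rel_struc_subset_rainbow[OF assms(3)]
  have "L_structure \<rho> r ?M"
    unfolding L_structure_def using assms(1) R rainbowD(2,3) by (fastforce simp del: rel_struc)
  moreover have "strong_colouring l ?M \<gamma>"
    unfolding strong_colouring_def
  proof (intro conjI allI ballI impI)
    show "\<gamma> \<in> univ ?M \<rightarrow> {1..l}" using assms(2) by simp
    fix k a i j assume "a \<in> rel ?M k" "i < length a" "j < length a" "i \<noteq> j"
    then show "\<gamma> (a ! i) \<noteq> \<gamma> (a ! j)"
      using R(2)[of a k] by (auto simp: rainbow_def distinct_conv_nth simp del: rel_struc)
  qed
  moreover have "irreflexive_rel (rel ?M k)" for k by (auto simp: irreflexive_rel_def)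
  moreover have "symmetric_rel (rel ?M k)" if "k \<in> I" for k
    using that by (auto simp: symmetric_rel_def key_def)
  ultimately show ?thesis by (simp add: coloured_structures_def)
qed

text \<open>The preimage \<open>W\<close> collects the keys of all tuples present. Different tuples
  share a key only in a symmetric relation, where they are permutations of each other, so nothing is
  lost or added.\<close>

lemma coloured_structures_eq_image:
  assumes "V \<noteq> {}" "\<gamma> \<in> V \<rightarrow> {1..l}"
  shows "coloured_structures \<gamma> V = struc V ` Pow (slots \<gamma> V)"
proof (intro equalityI subsetI)
  fix M assume "M \<in> coloured_structures \<gamma> V"
  then have M: "L_structure \<rho> r M" "univ M = V" "strong_colouring l M \<gamma>"
    "\<And>k. k \<in> I \<Longrightarrow> symmetric_rel (rel M k)" by (auto simp: coloured_structures_def)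
  define W where "W = {key k xs | k xs. xs \<in> rel M k}"
  have R: "k \<in> {1..\<rho>} \<and> xs \<in> rainbow \<gamma> V k" if "xs \<in> rel M k" for k xs
  proof -
    have "k \<in> {1..\<rho>}" using M(1) that unfolding L_structure_def by blast
    moreover from this have "length xs = r k \<and> set xs \<subseteq> V"
      using M(1,2) that unfolding L_structure_def by blast
    moreover have "distinct (map \<gamma> xs)"
      using M(3) that unfolding strong_colouring_def by (simp add: distinct_conv_nth)
    ultimately show ?thesis by (simp add: rainbow_def)
  qed
  have "W \<subseteq> slots \<gamma> V" using R by (fastforce simp: W_def slots_def)
  moreover have "xs \<in> rel M k" if xs: "distinct xs" "key k xs \<in> W" for k xs
  proof -
    obtain k' ys where ys: "ys \<in> rel M k'" "key k xs = key k' ys" using xs by (auto simp: W_def)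
    have dys: "distinct ys" using R[OF ys(1)] rainbowD(1) by blast
    note e = key_eqD[OF ys(2) xs(1) dys]
    show ?thesis
    proof (cases "k \<in> I")
      case True
      have "mset xs = mset ys" using e xs(1) dys by (metis set_eq_iff_mset_eq_distinct)
      then obtain \<sigma> where "\<sigma> permutes {..<length ys}" "permute_list \<sigma> ys = xs"
        by (rule mset_eq_permutation)
      then show ?thesis using M(4)[OF True] ys(1) e(1) by (auto simp: symmetric_rel_def)
    next
      case False
      then show ?thesis using ys e(1) by (simp add: key_def)
    qed
  qed
  then have "rel M k = rel (struc V W) k" for k
    using R rainbowD(1) by (fastforce simp: W_def)
  then have "M = struc V W" using M(2) by (cases M) (auto simp: struc_def)
  ultimately show "M \<in> struc V ` Pow (slots \<gamma> V)" by blast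
qed (use struc_in_coloured_structures[OF assms] in auto)

lemma inj_on_struc: "inj_on (struc V) (Pow (slots \<gamma> V))"
proof (rule inj_onI)
  have sub: "W \<subseteq> W'" if W: "W \<subseteq> slots \<gamma> V" "struc V W = struc V W'" for W W'
  proof
    fix q assume q: "q \<in> W"
    then obtain k xs where "xs \<in> rainbow \<gamma> V k" "q = key k xs"
      using W(1) by (auto simp: slots_def)
    moreover from this have "xs \<in> rel (struc V W) k" using q rainbowD(1) by auto
    ultimately show "q \<in> W'" unfolding W(2) by simp
  qed
  fix W W' assume "W \<in> Pow (slots \<gamma> V)" "W' \<in> Pow (slots \<gamma> V)" "struc V W = struc V W'"
  then show "W = W'" using sub[of W W'] sub[of W' W] by auto
qed

text \<open>A rainbow set can be ordered in \<open>fact (r k)\<close> ways, each a slot of its own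
  unless the relation is symmetric.\<close>

lemma card_slots:
  assumes "finite V"
  shows "card (slots \<gamma> V) =
    (\<Sum>k\<in>{1..\<rho>}. (if k \<in> I then 1 else fact (r k)) * card (rsets \<gamma> V (r k)))"
proof -
  have "card (slots \<gamma> V) = (\<Sum>k\<in>{1..\<rho>}. card (key k ` rainbow \<gamma> V k))"
    unfolding slots_def using assms
    by (intro card_UN_disjoint) (auto simp: finite_rainbow key_def)
  also have "\<dots> = (\<Sum>k\<in>{1..\<rho>}. (if k \<in> I then 1 else fact (r k)) * card (rsets \<gamma> V (r k)))"
  proof (rule sum.cong[OF refl])
    fix k
    show "card (key k ` rainbow \<gamma> V k) = (if k \<in> I then 1 else fact (r k)) * card (rsets \<gamma> V (r k))"
    proof (cases "k \<in> I")
      case True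
      have "set ` rainbow \<gamma> V k = rsets \<gamma> V (r k)"
      proof (intro equalityI subsetI)
        fix A assume "A \<in> set ` rainbow \<gamma> V k"
        then obtain xs where "xs \<in> rainbow \<gamma> V k" "A = set xs" by blast
        then show "A \<in> rsets \<gamma> V (r k)"
          using rainbowD[of xs \<gamma> V k] by (simp add: rsets_def distinct_card)
      next
        fix A assume A: "A \<in> rsets \<gamma> V (r k)"
        then have "finite A" using assms by (auto simp: rsets_def intro: finite_subset)
        then obtain xs where "set xs = A" "distinct xs" using finite_distinct_list by blast
        moreover from this have "xs \<in> rainbow \<gamma> V k"
          using A by (intro rainbowI) (auto simp: rsets_def distinct_card)
        ultimately show "A \<in> set ` rainbow \<gamma> V k" by blast
      qed
      moreover have "key k ` rainbow \<gamma> V k = (\<lambda>A. (k, Inr A)) ` set ` rainbow \<gamma> V k"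
        using True by (simp add: key_def image_image)
      ultimately show ?thesis using True by (simp add: card_image inj_on_def)
    next
      case False
      have "key k ` rainbow \<gamma> V k = (\<lambda>xs. (k, Inl xs)) ` rainbow \<gamma> V k"
        using False by (simp add: key_def)
      then have "card (key k ` rainbow \<gamma> V k) = card (rainbow \<gamma> V k)"
        by (simp add: card_image inj_on_def)
      also have "card (rainbow \<gamma> V k) = card (\<Union>A\<in>rsets \<gamma> V (r k). permutations_of_set A)"
        by (rule arg_cong[of _ _ card])
          (auto simp: rainbow_def rsets_def permutations_of_set_def distinct_map distinct_card)
      also have "\<dots> = (\<Sum>A\<in>rsets \<gamma> V (r k). card (permutations_of_set A))"
        using assms by (intro card_UN_disjoint)
          (auto simp: finite_rsets dest: permutations_of_setD)
      also have "\<dots> = (\<Sum>A\<in>rsets \<gamma> V (r k). fact (r k))"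
      proof (rule sum.cong[OF refl])
        fix A assume "A \<in> rsets \<gamma> V (r k)"
        then have "finite A" "card A = r k" using assms by (auto simp: rsets_def intro: finite_subset)
        then show "card (permutations_of_set A) = fact (r k)" by simp
      qed
      finally show ?thesis using False by simp
    qed
  qed
  finally show ?thesis .
qed

lemma slots_nonempty_iff:
  assumes "finite V"
  shows "slots \<gamma> V \<noteq> {} \<longleftrightarrow> (\<exists>k\<in>{1..\<rho>}. rsets \<gamma> V (r k) \<noteq> {})"
proof -
  have "slots \<gamma> V = {} \<longleftrightarrow> card (slots \<gamma> V) = 0" by (simp add: finite_slots assms)
  also have "\<dots> \<longleftrightarrow> (\<forall>k\<in>{1..\<rho>}. rsets \<gamma> V (r k) = {})"
    by (auto simp: card_slots finite_rsets assms)
  finally show ?thesis by auto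
qed

text \<open>Since \<open>r 1 \<le> l\<close>, the available colours suffice to fill a tuple of the
  first relation. In the contrapositive, a colouring without slots misses a colour.\<close>

lemma slots_nonempty_if_surj:
  assumes "finite V" "{1..l} \<subseteq> \<gamma> ` V"
  shows "slots \<gamma> V \<noteq> {}"
proof -
  have k: "1 \<in> {1..\<rho>}" using rho_pos by simp
  then have "{1..r 1} \<subseteq> \<gamma> ` V" using assms(2) arity_le_l[OF k] by auto
  then obtain U where U: "U \<subseteq> V" "inj_on \<gamma> U" "{1..r 1} = \<gamma> ` U"
    unfolding subset_image_inj by blast
  have "card U = r 1" using card_image[OF U(2)] U(3)[symmetric] by simp
  then show ?thesis using U k assms(1) by (auto simp: slots_nonempty_iff rsets_def)
qed

text \<open>Every rainbow set of \<open>r k - 2\<close> vertices outside both classes contributes at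
  least \<open>g\<close> new sets. So no relation loses, and a relation \<open>k0\<close> that has a
  slot gains at least \<open>g\<close> because it has such a smaller set.\<close>

lemma card_slots_recolour:
  assumes "finite V" "i \<noteq> j" "v \<in> V" "\<gamma> v = j" "slots \<gamma> V \<noteq> {}"
    and "card {x \<in> V. \<gamma> x = i} + g < card {x \<in> V. \<gamma> x = j}"
  shows "card (slots \<gamma> V) + g \<le> card (slots (\<gamma>(v := i)) V)"
proof -
  let ?g = "\<gamma>(v := i)"
  let ?c = "\<lambda>k. if k \<in> I then 1 else fact (r k) :: nat"
  let ?C = "\<lambda>k. card (rsets \<gamma> {x \<in> V. \<gamma> x \<noteq> i \<and> \<gamma> x \<noteq> j} (r k - 2))"
  have step: "card (rsets \<gamma> V (r k)) + g * ?C k \<le> card (rsets ?g V (r k))" if k: "k \<in> {1..\<rho>}" for k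
  proof -
    have rk: "r k = Suc (Suc (r k - 2))" using two_le_arity[OF k] by simp
    have "card (rsets ?g V (r k)) + Suc (card {x \<in> V. \<gamma> x = i}) * ?C k
      = card (rsets \<gamma> V (r k)) + card {x \<in> V. \<gamma> x = j} * ?C k"
      by (subst (1 3) rk) (rule card_rsets_recolour[of V i j v \<gamma>, OF assms(1-4)])
    moreover have "(Suc (card {x \<in> V. \<gamma> x = i}) + g) * ?C k \<le> card {x \<in> V. \<gamma> x = j} * ?C k"
      using assms(6) by (intro mult_right_mono) auto
    ultimately show ?thesis by (simp add: distrib_right)
  qed
  obtain k0 where k0: "k0 \<in> {1..\<rho>}" "rsets \<gamma> V (r k0) \<noteq> {}"
    using assms(1,5) slots_nonempty_iff by blast
  have rk0: "r k0 = Suc (Suc (r k0 - 2))" using two_le_arity[OF k0(1)] by simp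
  have "rsets \<gamma> {x \<in> V. \<gamma> x \<noteq> i \<and> \<gamma> x \<noteq> j} (r k0 - 2) \<noteq> {}"
    by (rule rsets_avoid_nonempty[OF assms(1)]) (use k0(2) rk0 in simp)
  then have C0: "1 \<le> ?C k0" using assms(1) by (simp add: finite_rsets card_gt_0_iff Suc_le_eq)
  have "g \<le> ?c k0 * (g * ?C k0)" using C0 by auto
  also have "\<dots> \<le> (\<Sum>k\<in>{1..\<rho>}. ?c k * (g * ?C k))"
    using k0(1) by (intro member_le_sum) auto
  finally have "card (slots \<gamma> V) + g \<le>
      (\<Sum>k\<in>{1..\<rho>}. ?c k * card (rsets \<gamma> V (r k))) + (\<Sum>k\<in>{1..\<rho>}. ?c k * (g * ?C k))"
    by (simp add: card_slots[OF assms(1)])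
  also have "\<dots> = (\<Sum>k\<in>{1..\<rho>}. ?c k * (card (rsets \<gamma> V (r k)) + g * ?C k))"
    by (simp only: distrib_left sum.distrib)
  also have "\<dots> \<le> (\<Sum>k\<in>{1..\<rho>}. ?c k * card (rsets ?g V (r k)))"
    by (intro sum_mono mult_left_mono step) auto
  also have "\<dots> = card (slots ?g V)" by (simp add: card_slots[OF assms(1)])
  finally show ?thesis .
qed

section \<open>Counting structures without the extension property\<close>

text \<open>What is left to decide about \<open>b\<close> relative to \<open>X\<close>. Slots that
  avoid \<open>b\<close> are excluded, which makes the sets for different candidates outside
  \<open>X\<close> disjoint and thus independent.\<close>

definition pat :: "('a \<Rightarrow> nat) \<Rightarrow> 'a set \<Rightarrow> 'a \<Rightarrow> (nat \<times> ('a list + 'a set)) set" where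
  "pat \<gamma> X b = (\<Union>k\<in>{1..\<rho>}. key k ` {xs \<in> rainbow \<gamma> (insert b X) k. b \<in> set xs})"

text \<open>The number 0 lies outside all universes and stands for the vertex to be found.\<close>

definition ext :: "nat \<Rightarrow> (nat \<Rightarrow> nat) \<Rightarrow> nat set \<Rightarrow> (nat \<times> (nat list + nat set)) set \<Rightarrow> bool" where
  "ext t \<gamma> V W \<longleftrightarrow> (\<forall>X c Q. X \<subseteq> V \<longrightarrow> card X < t \<longrightarrow> c \<in> {1..l} \<longrightarrow>
     (\<exists>b\<in>V - X. \<gamma> b = c \<and> (\<forall>q\<in>pat (\<gamma>(0 := c)) X 0. kmap (id(0 := b)) q \<in> W \<longleftrightarrow> q \<in> Q)))"

lemma pat_subset_slots: "b \<in> V \<Longrightarrow> X \<subseteq> V \<Longrightarrow> pat \<gamma> X b \<subseteq> slots \<gamma> V"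
  by (fastforce simp: pat_def slots_def rainbow_def)

lemma finite_pat: "finite X \<Longrightarrow> finite (pat \<gamma> X b)"
  by (auto simp: pat_def finite_rainbow)

text \<open>The bound does not depend on \<open>V\<close>: it fixes the base of the exponential
  decay in the failure probability.\<close>

lemma card_pat_le:
  assumes "finite X" "card X < t"
  shows "card (pat \<gamma> X b) \<le> \<rho> * t ^ l"
proof -
  have "card (pat \<gamma> X b) \<le> (\<Sum>k\<in>{1..\<rho>}. card (key k ` {xs \<in> rainbow \<gamma> (insert b X) k. b \<in> set xs}))"
    unfolding pat_def by (rule card_UN_le) simp
  also have "\<dots> \<le> (\<Sum>k\<in>{1..\<rho>}. t ^ l)"
  proof (rule sum_mono)
    fix k assume k: "k \<in> {1..\<rho>}"
    let ?L = "{xs. set xs \<subseteq> insert b X \<and> length xs = r k}"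
    have L: "finite ?L" using assms(1) by (intro finite_lists_length_eq) simp
    have "card (key k ` {xs \<in> rainbow \<gamma> (insert b X) k. b \<in> set xs}) \<le> card (key k ` ?L)"
      by (rule card_mono) (use L in \<open>auto simp: rainbow_def\<close>)
    also have "\<dots> \<le> card ?L" by (rule card_image_le[OF L])
    also have "\<dots> = card (insert b X) ^ r k" using assms(1) by (intro card_lists_length_eq) simp
    also have "\<dots> \<le> t ^ r k" using assms card_insert_le_m1 by (intro power_mono) (auto simp: card_insert_if)
    also have "\<dots> \<le> t ^ l" using assms(2) arity_le_l[OF k] by (intro power_increasing) auto
    finally show "card (key k ` {xs \<in> rainbow \<gamma> (insert b X) k. b \<in> set xs}) \<le> t ^ l" .
  qed
  finally show ?thesis by simp
qed

text \<open>A common slot would contain \<open>b\<close> and lie inside \<open>insert b' X\<close>,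
  which \<open>b\<close> does not belong to.\<close>

lemma pat_disjoint:
  assumes "b \<noteq> b'" "b \<notin> X"
  shows "pat \<gamma> X b \<inter> pat \<gamma> X b' = {}"
proof (rule equals0I)
  fix q assume "q \<in> pat \<gamma> X b \<inter> pat \<gamma> X b'"
  then obtain k xs k' ys where *: "xs \<in> rainbow \<gamma> (insert b X) k" "b \<in> set xs" "q = key k xs"
    "ys \<in> rainbow \<gamma> (insert b' X) k'" "q = key k' ys" by (auto simp: pat_def)
  then have "set xs = set ys"
    using key_eqD(2)[of k xs k' ys] rainbowD(1) by metis
  then show False using * rainbowD(3)[OF *(4)] assms by auto
qed

context
  fixes V X :: "nat set" and b c :: nat and \<gamma> :: "nat \<Rightarrow> nat"
  assumes ctx: "0 \<notin> V" "X \<subseteq> V" "b \<in> V - X" "\<gamma> b = c"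
begin

lemma inj_placeholder: "inj_on (id(0 := b)) (insert 0 X)"
  using ctx by (auto simp: inj_on_def)

text \<open>The placeholder lets one demand be posed to all candidates at once; replacing it by a
  vertex \<open>b\<close> of the demanded colour translates the demand into slots through
  \<open>b\<close>.\<close>

lemma kmap_placeholder_in_pat:
  assumes "q \<in> pat (\<gamma>(0 := c)) X 0"
  shows "kmap (id(0 := b)) q \<in> pat \<gamma> X b"
proof -
  obtain k xs where xs: "k \<in> {1..\<rho>}" "xs \<in> rainbow (\<gamma>(0 := c)) (insert 0 X) k" "0 \<in> set xs" "q = key k xs"
    using assms by (auto simp: pat_def)
  have "map \<gamma> (map (id(0 := b)) xs) = map (\<gamma>(0 := c)) xs" using ctx by auto
  then have "map (id(0 := b)) xs \<in> rainbow \<gamma> (insert b X) k"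
    using xs(2) unfolding rainbow_def by (auto simp del: map_map split: if_splits)
  moreover have "b \<in> set (map (id(0 := b)) xs)" using xs(3) by force
  ultimately have "key k (map (id(0 := b)) xs) \<in> pat \<gamma> X b" using xs(1) unfolding pat_def by blast
  then show ?thesis by (simp add: xs(4) key_map)
qed

text \<open>Different slots of the pattern impose conditions on different members of
  \<open>W\<close>, so no demand \<open>Q\<close> is contradictory.\<close>

lemma inj_on_kmap_placeholder: "inj_on (kmap (id(0 := b))) (pat (\<gamma>(0 := c)) X 0)"
proof (rule inj_onI)
  let ?f = "id(0 := b)"
  fix q q' assume "q \<in> pat (\<gamma>(0 := c)) X 0" "q' \<in> pat (\<gamma>(0 := c)) X 0" and eq: "kmap ?f q = kmap ?f q'"
  then obtain k xs k' ys where *: "xs \<in> rainbow (\<gamma>(0 := c)) (insert 0 X) k" "q = key k xs"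
    "ys \<in> rainbow (\<gamma>(0 := c)) (insert 0 X) k'" "q' = key k' ys" by (auto simp: pat_def)
  note sub = rainbowD(3)[OF *(1)] rainbowD(3)[OF *(3)]
  have e: "key k (map ?f xs) = key k' (map ?f ys)" using eq * by (simp add: key_map)
  show "q = q'"
  proof (cases "k \<in> I")
    case True
    then have "k' = k" "?f ` set xs = ?f ` set ys" using e by (auto simp: key_def split: if_splits)
    then show ?thesis
      using inj_on_image_eq_iff[OF inj_placeholder sub] * True by (simp add: key_def)
  next
    case False
    then have "k' = k" "map ?f xs = map ?f ys" using e by (auto simp: key_def split: if_splits)
    moreover have "inj_on ?f (set xs \<union> set ys)"
      using sub by (intro inj_on_subset[OF inj_placeholder]) auto
    ultimately show ?thesis using * inj_on_map_eq_map by metis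
  qed
qed

end

text \<open>Listing a set and padding with \<open>0\<close>, which is outside \<open>V\<close>,
  gives a list of length exactly \<open>t\<close> over \<open>card V + 1\<close> letters, from which
  the set can be read off.\<close>

lemma card_small_subsets_le:
  assumes "finite (V :: nat set)" "0 \<notin> V"
  shows "card {X. X \<subseteq> V \<and> card X < t} \<le> (card V + 1) ^ t"
proof -
  let ?L = "{xs. set xs \<subseteq> insert 0 V \<and> length xs = t}"
  have "{X. X \<subseteq> V \<and> card X < t} \<subseteq> (\<lambda>xs. set xs \<inter> V) ` ?L"
  proof
    fix X assume X: "X \<in> {X. X \<subseteq> V \<and> card X < t}"
    then have "finite X" using assms(1) finite_subset by auto
    then obtain xs where xs: "set xs = X" "distinct xs" using finite_distinct_list by blast
    let ?ys = "xs @ replicate (t - length xs) 0"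
    have "length xs < t" using xs X by (metis (no_types, lifting) distinct_card mem_Collect_eq)
    then have "?ys \<in> ?L" using X xs by auto
    moreover have "X = set ?ys \<inter> V" using X xs assms(2) by auto
    ultimately show "X \<in> (\<lambda>xs. set xs \<inter> V) ` ?L" by blast
  qed
  then have "card {X. X \<subseteq> V \<and> card X < t} \<le> card ?L"
    using assms(1) by (intro surj_card_le finite_lists_length_eq) auto
  also have "\<dots> = (card V + 1) ^ t"
    using assms by (subst card_lists_length_eq) auto
  finally show ?thesis .
qed

text \<open>Union bound over the set \<open>Z\<close> of demands, each a vertex set
  \<open>X\<close>, a colour \<open>c\<close> and a pattern \<open>Q\<close>. The first three
  factors bound their number; each demand has at least \<open>s - t\<close> candidates, the vertices
  of colour \<open>c\<close> outside \<open>X\<close>, and these fail independently.\<close>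

lemma card_not_ext_le:
  fixes V :: "nat set" and t :: nat
  defines "m \<equiv> \<rho> * t ^ l"
  assumes V: "finite V" "0 \<notin> V"
    and s: "\<And>c. c \<in> {1..l} \<Longrightarrow> s \<le> card {x \<in> V. \<gamma> x = c}"
  shows "real (card {W \<in> Pow (slots \<gamma> V). \<not> ext t \<gamma> V W})
    \<le> (real (card V) + 1) ^ t * real l * 2 ^ m * (1 - 1 / 2 ^ m) ^ (s - t) * 2 ^ card (slots \<gamma> V)"
proof -
  let ?XX = "{X. X \<subseteq> V \<and> card X < t}"
  let ?q = "1 - 1 / 2 ^ m :: real"
  let ?E = "2 ^ card (slots \<gamma> V) * ?q ^ (s - t)"
  define Z where "Z = Sigma ?XX (\<lambda>X. Sigma {1..l} (\<lambda>c. Pow (pat (\<gamma>(0 := c)) X 0)))"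
  define B where "B = (\<lambda>X c. {b \<in> V - X. \<gamma> b = c})"
  define F where "F = (\<lambda>(X, c, Q). {W. W \<subseteq> slots \<gamma> V \<and>
    (\<forall>b\<in>B X c. W \<inter> pat \<gamma> X b \<noteq> kmap (id(0 := b)) ` Q)})"
  have finX: "finite X" if "X \<subseteq> V" for X using that V(1) finite_subset by blast
  have finXX: "finite ?XX" using V(1) by (auto intro: finite_subset[of _ "Pow V"])
  have finZ: "finite Z" unfolding Z_def using finXX
    by (intro finite_SigmaI) (auto simp: finite_pat finX)
  have "{W \<in> Pow (slots \<gamma> V). \<not> ext t \<gamma> V W} \<subseteq> (\<Union>z\<in>Z. F z)"
  proof
    fix W assume "W \<in> {W \<in> Pow (slots \<gamma> V). \<not> ext t \<gamma> V W}"
    then have W: "W \<subseteq> slots \<gamma> V" "\<not> ext t \<gamma> V W" by auto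
    then obtain X c Q where X: "X \<subseteq> V" "card X < t" "c \<in> {1..l}" and no:
      "\<not> (\<exists>b\<in>V - X. \<gamma> b = c \<and>
        (\<forall>q\<in>pat (\<gamma>(0 := c)) X 0. kmap (id(0 := b)) q \<in> W \<longleftrightarrow> q \<in> Q))"
      unfolding ext_def not_all not_imp by (elim exE conjE) (rule that)
    let ?P = "pat (\<gamma>(0 := c)) X 0"
    \<comment> \<open>A candidate with exactly this trace would meet the demand. Cutting
      \<open>Q\<close> down to the pattern does not alter the demand and leaves finitely many of
      them.\<close>
    have "W \<inter> pat \<gamma> X b \<noteq> kmap (id(0 := b)) ` (Q \<inter> ?P)" if b: "b \<in> B X c" for b
    proof
      assume eq: "W \<inter> pat \<gamma> X b = kmap (id(0 := b)) ` (Q \<inter> ?P)"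
      have b': "b \<in> V - X" "\<gamma> b = c" using b by (auto simp: B_def)
      have "kmap (id(0 := b)) q \<in> W \<longleftrightarrow> q \<in> Q" if q: "q \<in> ?P" for q
      proof -
        have "kmap (id(0 := b)) q \<in> W \<longleftrightarrow> kmap (id(0 := b)) q \<in> W \<inter> pat \<gamma> X b"
          using kmap_placeholder_in_pat[of V X b \<gamma> c, OF V(2) X(1) b' q] by simp
        also have "\<dots> \<longleftrightarrow> q \<in> Q \<inter> ?P"
          unfolding eq
          by (rule inj_on_image_mem_iff[OF inj_on_kmap_placeholder[of V X b \<gamma> c, OF V(2) X(1) b'] q]) simp
        finally show ?thesis using q by simp
      qed
      then have "\<forall>q\<in>?P. kmap (id(0 := b)) q \<in> W \<longleftrightarrow> q \<in> Q" by (rule ballI)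
      then show False using no b' by blast
    qed
    then have "W \<in> F (X, c, Q \<inter> ?P)" using W(1) by (auto simp: F_def)
    moreover have "(X, c, Q \<inter> ?P) \<in> Z" using X by (auto simp: Z_def)
    ultimately show "W \<in> (\<Union>z\<in>Z. F z)" by blast
  qed
  moreover have "finite (\<Union>z\<in>Z. F z)"
  proof (rule finite_subset)
    show "(\<Union>z\<in>Z. F z) \<subseteq> Pow (slots \<gamma> V)" by (rule UN_least) (auto simp: F_def split: prod.splits)
    show "finite (Pow (slots \<gamma> V))" using V(1) by (simp add: finite_slots)
  qed
  ultimately have "card {W \<in> Pow (slots \<gamma> V). \<not> ext t \<gamma> V W} \<le> card (\<Union>z\<in>Z. F z)"
    by (rule card_mono[rotated])
  also have "\<dots> \<le> (\<Sum>z\<in>Z. card (F z))" by (rule card_UN_le[OF finZ])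
  finally have "real (card {W \<in> Pow (slots \<gamma> V). \<not> ext t \<gamma> V W}) \<le> (\<Sum>z\<in>Z. real (card (F z)))"
    by (simp flip: of_nat_sum)
  also have "\<dots> \<le> (\<Sum>z\<in>Z. ?E)"
  proof (rule sum_mono)
    fix z assume "z \<in> Z"
    then obtain X c Q where z: "z = (X, c, Q)" and X: "X \<subseteq> V" "card X < t" "c \<in> {1..l}"
      "Q \<subseteq> pat (\<gamma>(0 := c)) X 0" by (auto simp: Z_def)
    have BV: "B X c \<subseteq> V" "finite (B X c)" using V(1) by (auto simp: B_def)
    have "real (card (F z)) \<le> 2 ^ card (slots \<gamma> V) * ?q ^ card (B X c)"
      unfolding z F_def prod.case
    proof (rule card_avoid_le[OF BV(2) finite_slots[OF V(1)]])
      fix b assume b: "b \<in> B X c"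
      show "pat \<gamma> X b \<subseteq> slots \<gamma> V" using b BV(1) X(1) by (intro pat_subset_slots) auto
      show "card (pat \<gamma> X b) \<le> m" unfolding m_def by (rule card_pat_le[OF finX[OF X(1)] X(2)])
      show "kmap (id(0 := b)) ` Q \<subseteq> pat \<gamma> X b"
        using kmap_placeholder_in_pat[of V X b \<gamma> c, OF V(2) X(1)] b X(4) by (auto simp: B_def)
      show "pat \<gamma> X b \<inter> pat \<gamma> X b' = {}" if "b \<noteq> b'" for b'
        using b that by (intro pat_disjoint) (auto simp: B_def)
    qed
    also have "\<dots> \<le> ?E"
    proof -
      have "{x \<in> V. \<gamma> x = c} \<subseteq> B X c \<union> X" by (auto simp: B_def)
      then have "card {x \<in> V. \<gamma> x = c} \<le> card (B X c \<union> X)"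
        using BV(2) finX[OF X(1)] by (intro card_mono) auto
      also have "\<dots> \<le> card (B X c) + card X" by (rule card_Un_le)
      finally have "s - t \<le> card (B X c)" using s[OF X(3)] X(2) by linarith
      then show ?thesis by (intro mult_left_mono power_decreasing) auto
    qed
    finally show "real (card (F z)) \<le> ?E" .
  qed
  also have "\<dots> = real (card Z) * ?E" by simp
  also have "\<dots> \<le> (real (card V) + 1) ^ t * real l * 2 ^ m * ?E"
  proof (rule mult_right_mono)
    have "card Z = (\<Sum>X\<in>?XX. \<Sum>c\<in>{1..l}. card (Pow (pat (\<gamma>(0 := c)) X 0)))"
      unfolding Z_def using finXX finite_pat[OF finX]
      by (subst card_SigmaI) (auto intro!: sum.cong card_SigmaI finite_SigmaI)
    also have "\<dots> \<le> (\<Sum>X\<in>?XX. \<Sum>c\<in>{1..l}. 2 ^ m)"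
      unfolding m_def using finX by (intro sum_mono) (auto simp: card_Pow finite_pat intro!: card_pat_le)
    also have "\<dots> = card ?XX * (l * 2 ^ m)" by simp
    also have "\<dots> \<le> (card V + 1) ^ t * (l * 2 ^ m)"
      by (intro mult_right_mono card_small_subsets_le V) simp
    finally have "real (card Z) \<le> real ((card V + 1) ^ t * (l * 2 ^ m))" by (rule of_nat_mono)
    then show "real (card Z) \<le> (real (card V) + 1) ^ t * real l * 2 ^ m" by (simp add: mult_ac add_ac)
  qed simp
  finally show ?thesis by (simp add: mult_ac)
qed

section \<open>Weight of the colourings with a small class or without slots\<close>

text \<open>For nonempty \<open>V\<close> this is the number of pairs of a colouring and a structure
  that it strongly colours, the total against which all errors are measured.\<close>

definition weight :: "nat set \<Rightarrow> nat" where
  "weight V = (\<Sum>\<gamma>\<in>V \<rightarrow>\<^sub>E {1..l}. 2 ^ card (slots \<gamma> V))"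

lemma finite_colourings: "finite V \<Longrightarrow> finite (V \<rightarrow>\<^sub>E {1..l})"
  by (rule finite_PiE) auto

text \<open>Some class \<open>j\<close> has at least the average size \<open>n / l\<close>, so it
  exceeds class \<open>i\<close> by more than \<open>n / (2 l)\<close>, and any of its vertices may
  be moved to \<open>i\<close>.\<close>

lemma exists_gain:
  assumes V: "finite V" and \<gamma>: "\<gamma> \<in> V \<rightarrow>\<^sub>E {1..l}" and ne: "slots \<gamma> V \<noteq> {}"
    and i: "i \<in> {1..l}" "4 * l * card {x \<in> V. \<gamma> x = i} < card V"
  shows "\<exists>v\<in>V. card (slots \<gamma> V) + card V div (2 * l) \<le> card (slots (\<gamma>(v := i)) V)"
proof -
  let ?n = "card V" and ?c = "\<lambda>c. card {x \<in> V. \<gamma> x = c}"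
  have "\<exists>j\<in>{1..l}. ?n \<le> l * ?c j"
  proof (rule ccontr)
    assume "\<not> ?thesis"
    then have "(\<Sum>c\<in>{1..l}. l * ?c c) < (\<Sum>c\<in>{1..l}. ?n)"
      using i(1) by (intro sum_strict_mono) (auto simp: not_le)
    also have "(\<Sum>c\<in>{1..l}. l * ?c c) = l * card (\<Union>c\<in>{1..l}. {x \<in> V. \<gamma> x = c})"
      using V by (subst card_UN_disjoint) (auto simp: sum_distrib_left)
    also have "(\<Union>c\<in>{1..l}. {x \<in> V. \<gamma> x = c}) = V" using \<gamma> by (auto simp: PiE_iff)
    finally show False by simp
  qed
  then obtain j where j: "j \<in> {1..l}" "?n \<le> l * ?c j" by blast
  have "4 * (l * ?c i) < ?n" using i(2) by (simp add: mult_ac)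
  then have ij: "i \<noteq> j" using j(2) by auto
  have "2 * l * (?n div (2 * l)) \<le> ?n" by simp
  \<comment> \<open>On the left the two summands contribute less than \<open>n\<close> and at most
    \<open>2 n\<close>; the right side is at least \<open>4 n\<close>.\<close>
  then have "4 * (l * (?c i + ?n div (2 * l))) < 4 * (l * ?c j)"
    using \<open>4 * (l * ?c i) < ?n\<close> j(2) by (simp add: algebra_simps)
  then have gap: "?c i + ?n div (2 * l) < ?c j" by simp
  then have "{x \<in> V. \<gamma> x = j} \<noteq> {}" by force
  then obtain v where v: "v \<in> V" "\<gamma> v = j" by blast
  then show ?thesis using card_slots_recolour[OF V ij v ne gap] by blast
qed

text \<open>One move multiplies the number of structures of a colouring by at least
  \<open>2 ^ (n div (2 * l))\<close>, and no colouring is the result of more than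
  \<open>n * l\<close> chosen moves.\<close>

lemma unbalanced_weight_le:
  fixes V :: "nat set"
  assumes V: "finite V"
  defines "n \<equiv> card V"
  shows "(\<Sum>\<gamma> | \<gamma> \<in> V \<rightarrow>\<^sub>E {1..l} \<and> slots \<gamma> V \<noteq> {} \<and> (\<exists>i\<in>{1..l}. 4 * l * card {x \<in> V. \<gamma> x = i} < n).
      2 ^ card (slots \<gamma> V)) * 2 ^ (n div (2 * l)) \<le> n * l * weight V"
    (is "sum ?e ?U * _ \<le> _")
proof -
  have "\<exists>p. fst p \<in> V \<and> snd p \<in> {1..l} \<and>
      card (slots \<gamma> V) + n div (2 * l) \<le> card (slots (\<gamma>(fst p := snd p)) V)"
    if \<gamma>: "\<gamma> \<in> ?U" for \<gamma>
  proof -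
    obtain i where i: "i \<in> {1..l}" "4 * l * card {x \<in> V. \<gamma> x = i} < card V"
      using \<gamma> unfolding n_def by blast
    obtain v where "v \<in> V" "card (slots \<gamma> V) + card V div (2 * l) \<le> card (slots (\<gamma>(v := i)) V)"
      using exists_gain[OF V _ _ i] \<gamma> by auto
    then show ?thesis using i(1) unfolding n_def by (intro exI[of _ "(v, i)"]) simp
  qed
  then have "\<forall>\<gamma>\<in>?U. \<exists>p. fst p \<in> V \<and> snd p \<in> {1..l} \<and>
      card (slots \<gamma> V) + n div (2 * l) \<le> card (slots (\<gamma>(fst p := snd p)) V)" by (rule ballI)
  from bchoice[OF this] obtain p where p: "\<forall>\<gamma>\<in>?U. fst (p \<gamma>) \<in> V \<and> snd (p \<gamma>) \<in> {1..l} \<and>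
      card (slots \<gamma> V) + n div (2 * l) \<le> card (slots (\<gamma>(fst (p \<gamma>) := snd (p \<gamma>))) V)" by (rule exE)
  define f h where "f = (\<lambda>\<gamma>. fst (p \<gamma>))" and "h = (\<lambda>\<gamma>. snd (p \<gamma>))"
  have fh: "f \<gamma> \<in> V" "h \<gamma> \<in> {1..l}"
    "card (slots \<gamma> V) + n div (2 * l) \<le> card (slots (\<gamma>(f \<gamma> := h \<gamma>)) V)" if "\<gamma> \<in> ?U" for \<gamma>
    using bspec[OF p that] unfolding f_def h_def by blast+
  \<comment> \<open>A colouring is recovered from its modification, the recoloured vertex and the old colour.\<close>
  define \<phi> where "\<phi> = (\<lambda>\<gamma>. (f \<gamma>, \<gamma> (f \<gamma>), \<gamma>(f \<gamma> := h \<gamma>)))"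
  have "inj_on \<phi> ?U"
  proof (rule inj_on_inverseI)
    show "(\<lambda>(v, j, \<gamma>). \<gamma>(v := j)) (\<phi> \<gamma>) = \<gamma>" for \<gamma> by (simp add: \<phi>_def)
  qed
  moreover have "\<phi> ` ?U \<subseteq> V \<times> {1..l} \<times> (V \<rightarrow>\<^sub>E {1..l})"
  proof (rule image_subsetI)
    fix \<gamma> assume g: "\<gamma> \<in> ?U"
    then have "\<gamma> (f \<gamma>) \<in> {1..l}" using fh(1)[OF g] by (auto simp: PiE_iff)
    moreover have "\<gamma>(f \<gamma> := h \<gamma>) \<in> V \<rightarrow>\<^sub>E {1..l}"
      using g fh(1,2)[OF g] by (auto simp: PiE_iff extensional_def)
    ultimately show "\<phi> \<gamma> \<in> V \<times> {1..l} \<times> (V \<rightarrow>\<^sub>E {1..l})" using fh(1)[OF g] by (simp add: \<phi>_def)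
  qed
  moreover have "sum ?e ?U * 2 ^ (n div (2 * l)) = (\<Sum>\<gamma>\<in>?U. 2 ^ (card (slots \<gamma> V) + n div (2 * l)))"
    by (simp add: sum_distrib_right power_add)
  moreover have "\<dots> \<le> (\<Sum>\<gamma>\<in>?U. 2 ^ card (slots (snd (snd (\<phi> \<gamma>))) V))"
    using fh(3) by (intro sum_mono power_increasing) (auto simp: \<phi>_def)
  ultimately have "sum ?e ?U * 2 ^ (n div (2 * l)) \<le> (\<Sum>z\<in>\<phi> ` ?U. 2 ^ card (slots (snd (snd z)) V))"
    by (simp add: sum.reindex)
  also have "\<dots> \<le> (\<Sum>z\<in>V \<times> {1..l} \<times> (V \<rightarrow>\<^sub>E {1..l}). 2 ^ card (slots (snd (snd z)) V))"
    using \<open>\<phi> ` ?U \<subseteq> _\<close> by (intro sum_mono2 finite_cartesian_product finite_colourings V) auto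
  also have "\<dots> = n * l * weight V"
    by (simp add: weight_def n_def sum.cartesian_product' mult.assoc)
  finally show ?thesis .
qed

lemma slotless_colourings_le:
  fixes V :: "nat set"
  assumes V: "finite V"
  shows "card {\<gamma> \<in> V \<rightarrow>\<^sub>E {1..l}. slots \<gamma> V = {}} \<le> l * (l - 1) ^ card V"
proof -
  have "{\<gamma> \<in> V \<rightarrow>\<^sub>E {1..l}. slots \<gamma> V = {}} \<subseteq> (\<Union>c\<in>{1..l}. V \<rightarrow>\<^sub>E {1..l} - {c})"
  proof
    fix \<gamma> assume \<gamma>: "\<gamma> \<in> {\<gamma> \<in> V \<rightarrow>\<^sub>E {1..l}. slots \<gamma> V = {}}"
    then obtain c where "c \<in> {1..l}" "c \<notin> \<gamma> ` V" using slots_nonempty_if_surj[OF V] by blast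
    then have "\<gamma> \<in> V \<rightarrow>\<^sub>E {1..l} - {c}" using \<gamma> by (auto simp: PiE_iff)
    then show "\<gamma> \<in> (\<Union>c\<in>{1..l}. V \<rightarrow>\<^sub>E {1..l} - {c})" using \<open>c \<in> {1..l}\<close> by blast
  qed
  then have "card {\<gamma> \<in> V \<rightarrow>\<^sub>E {1..l}. slots \<gamma> V = {}} \<le> card (\<Union>c\<in>{1..l}. V \<rightarrow>\<^sub>E {1..l} - {c})"
    using V by (intro card_mono) (auto intro!: finite_PiE)
  also have "\<dots> \<le> (\<Sum>c\<in>{1..l}. card (V \<rightarrow>\<^sub>E {1..l} - {c}))" by (rule card_UN_le) simp
  also have "\<dots> = (\<Sum>c\<in>{1..l}. (l - 1) ^ card V)"
    using V by (intro sum.cong) (auto simp: card_PiE)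
  finally show ?thesis by simp
qed

text \<open>Each colouring admits at least the structure without tuples. Compared with
  \<open>l ^ n\<close>, the at most \<open>l * (l - 1) ^ n\<close> colourings without slots are
  negligible.\<close>

lemma weight_ge: "finite V \<Longrightarrow> l ^ card V \<le> weight V"
proof -
  assume V: "finite V"
  have "l ^ card V = (\<Sum>\<gamma>\<in>V \<rightarrow>\<^sub>E {1..l}. 1)" using V by (simp add: card_PiE)
  also have "\<dots> \<le> weight V" unfolding weight_def by (rule sum_mono) simp
  finally show ?thesis .
qed

text \<open>The terms bound, relative to \<open>weight\<close>, the colourings with a small class,
  those without slots, and the failures of the extension property when every class has at least
  \<open>n div (4 * l)\<close> vertices.\<close>

definition error :: "nat \<Rightarrow> nat \<Rightarrow> real" where
  "error t n = real n * l / 2 ^ (n div (2 * l)) + l * (real (l - 1) / l) ^ n +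
     (real n + 1) ^ t * l * 2 ^ (\<rho> * t ^ l) * (1 - 1 / 2 ^ (\<rho> * t ^ l)) ^ (n div (4 * l) - t)"

lemma sum_not_ext_le:
  fixes V :: "nat set"
  assumes V: "finite V" "0 \<notin> V"
  shows "(\<Sum>\<gamma>\<in>V \<rightarrow>\<^sub>E {1..l}. real (card {W \<in> Pow (slots \<gamma> V). \<not> ext t \<gamma> V W}))
    \<le> error t (card V) * weight V"
proof -
  let ?n = "card V" and ?G = "V \<rightarrow>\<^sub>E {1..l}" and ?m = "\<rho> * t ^ l"
  let ?bad = "\<lambda>\<gamma>. real (card {W \<in> Pow (slots \<gamma> V). \<not> ext t \<gamma> V W})"
  let ?unb = "\<lambda>\<gamma>. \<exists>i\<in>{1..l}. 4 * l * card {x \<in> V. \<gamma> x = i} < ?n"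
  let ?K = "(real ?n + 1) ^ t * real l * 2 ^ ?m * (1 - 1 / 2 ^ ?m) ^ (?n div (4 * l) - t)"
  \<comment> \<open>All pairs over \<open>A\<close> and \<open>B\<close> are given up; over
    \<open>C\<close> the union bound applies. \<open>B\<close> and \<open>C\<close> may overlap, as
    only an upper bound for the sum is sought.\<close>
  define A where "A = {\<gamma>. \<gamma> \<in> ?G \<and> slots \<gamma> V \<noteq> {} \<and> ?unb \<gamma>}"
  define B where "B = {\<gamma> \<in> ?G. slots \<gamma> V = {}}"
  define C where "C = {\<gamma> \<in> ?G. \<not> ?unb \<gamma>}"
  have fin: "finite ?G" by (rule finite_colourings[OF V(1)])
  have finABC: "finite A" "finite B" "finite C" using fin by (auto simp: A_def B_def C_def)
  have le: "?bad \<gamma> \<le> 2 ^ card (slots \<gamma> V)" for \<gamma>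
  proof -
    have "card {W \<in> Pow (slots \<gamma> V). \<not> ext t \<gamma> V W} \<le> card (Pow (slots \<gamma> V))"
      using V(1) by (intro card_mono) (auto simp: finite_slots)
    then have "?bad \<gamma> \<le> real (2 ^ card (slots \<gamma> V))"
      unfolding card_Pow[OF finite_slots[OF V(1)]] by (rule of_nat_mono)
    then show ?thesis by simp
  qed
  have "sum ?bad ?G \<le> sum ?bad (A \<union> B \<union> C)"
    using finABC by (intro sum_mono2) (auto simp: A_def B_def C_def)
  also have "\<dots> \<le> sum ?bad A + sum ?bad B + sum ?bad C"
  proof -
    have "sum ?bad (A \<union> B \<union> C) \<le> sum ?bad (A \<union> B) + sum ?bad C"
      using finABC by (subst sum_Un) (auto intro!: sum_nonneg)
    moreover have "sum ?bad (A \<union> B) \<le> sum ?bad A + sum ?bad B"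
      using finABC by (subst sum_Un) (auto intro!: sum_nonneg)
    ultimately show ?thesis by simp
  qed
  also have "sum ?bad A \<le> real ?n * l / 2 ^ (?n div (2 * l)) * weight V"
  proof -
    have "sum ?bad A \<le> (\<Sum>\<gamma>\<in>A. 2 ^ card (slots \<gamma> V))" by (intro sum_mono le)
    also have "\<dots> = real (\<Sum>\<gamma>\<in>A. 2 ^ card (slots \<gamma> V))" by simp
    finally have "sum ?bad A * 2 ^ (?n div (2 * l)) \<le>
        real ((\<Sum>\<gamma>\<in>A. 2 ^ card (slots \<gamma> V)) * 2 ^ (?n div (2 * l)))"
      by simp
    also have "\<dots> \<le> real (?n * l * weight V)"
      using unbalanced_weight_le[OF V(1)] unfolding A_def by (rule of_nat_mono)
    finally show ?thesis by (simp add: field_simps)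
  qed
  also have "sum ?bad B \<le> l * (real (l - 1) / l) ^ ?n * weight V"
  proof -
    have "sum ?bad B \<le> (\<Sum>\<gamma>\<in>B. 2 ^ card (slots \<gamma> V))" by (intro sum_mono le)
    \<comment> \<open>A colouring without slots carries a single structure, the one without
      tuples.\<close>
    also have "\<dots> = real (card B)" by (simp add: B_def)
    also have "\<dots> \<le> real (l * (l - 1) ^ ?n)"
      using slotless_colourings_le[OF V(1)] unfolding B_def by (rule of_nat_mono)
    also have "\<dots> = l * (real (l - 1) / l) ^ ?n * real (l ^ ?n)"
      using two_le_l by (simp add: power_divide)
    also have "\<dots> \<le> l * (real (l - 1) / l) ^ ?n * weight V"
      by (intro mult_left_mono of_nat_mono weight_ge V(1)) simp
    finally show ?thesis .
  qed
  also have "sum ?bad C \<le> ?K * weight V"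
  proof -
    have "sum ?bad C \<le> (\<Sum>\<gamma>\<in>C. ?K * 2 ^ card (slots \<gamma> V))"
    proof (rule sum_mono)
      fix \<gamma> assume "\<gamma> \<in> C"
      then have "?n div (4 * l) \<le> card {x \<in> V. \<gamma> x = c}" if "c \<in> {1..l}" for c
      proof -
        have "?n \<le> 4 * l * card {x \<in> V. \<gamma> x = c}" using \<open>\<gamma> \<in> C\<close> that by (auto simp: C_def not_less)
        then have "?n div (4 * l) \<le> 4 * l * card {x \<in> V. \<gamma> x = c} div (4 * l)" by (rule div_le_mono)
        then show ?thesis using two_le_l by simp
      qed
      then show "?bad \<gamma> \<le> ?K * 2 ^ card (slots \<gamma> V)" by (rule card_not_ext_le[OF V])
    qed
    also have "\<dots> \<le> (\<Sum>\<gamma>\<in>?G. ?K * 2 ^ card (slots \<gamma> V))"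
      using fin by (intro sum_mono2) (auto simp: C_def)
    also have "\<dots> = ?K * weight V" by (simp add: weight_def sum_distrib_left)
    finally show ?thesis .
  qed
  finally show ?thesis by (simp add: error_def algebra_simps)
qed

section \<open>Cliques and the partition into colour classes\<close>

definition saturated :: "nat \<Rightarrow> (nat \<Rightarrow> nat) \<Rightarrow> nat set \<Rightarrow> (nat \<times> (nat list + nat set)) set \<Rightarrow> bool" where
  "saturated t \<gamma> V W \<longleftrightarrow>
     finite V \<and> 0 \<notin> V \<and> \<gamma> \<in> V \<rightarrow> {1..l} \<and> W \<subseteq> slots \<gamma> V \<and> ext t \<gamma> V W"

lemma saturatedD:
  assumes "saturated t \<gamma> V W"
  shows "finite V" "0 \<notin> V" "\<gamma> \<in> V \<rightarrow> {1..l}" "W \<subseteq> slots \<gamma> V" "ext t \<gamma> V W"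
  using assms by (auto simp: saturated_def)

lemma extD:
  assumes "ext t \<gamma> V W" "X \<subseteq> V" "card X < t" "c \<in> {1..l}"
  obtains b where "b \<in> V - X" "\<gamma> b = c"
    "\<forall>q\<in>pat (\<gamma>(0 := c)) X 0. kmap (id(0 := b)) q \<in> W \<longleftrightarrow> q \<in> Q"
proof -
  have "\<exists>b\<in>V - X. \<gamma> b = c \<and> (\<forall>q\<in>pat (\<gamma>(0 := c)) X 0. kmap (id(0 := b)) q \<in> W \<longleftrightarrow> q \<in> Q)"
    using assms unfolding ext_def by simp
  then show thesis by (elim bexE conjE) (rule that)
qed

text \<open>The entries are indices of vertices, and later variables of a formula. All orderings are
  listed, so that symmetric and other first relations are treated alike.\<close>

definition clique_lists :: "nat list set" where
  "clique_lists = {xs. length xs = r 1 \<and> distinct xs \<and> set xs \<subseteq> {..l} \<and> \<not> {0, 1} \<subseteq> set xs}"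

text \<open>The vertices \<open>g 0\<close> and \<open>g 1\<close> may coincide; each of them forms with \<open>g 2, \<dots>, g l\<close> a
  set of \<open>l\<close> vertices any two of which occur together in a tuple of the first relation.\<close>

definition clique :: "'a rel_struct \<Rightarrow> (nat \<Rightarrow> 'a) \<Rightarrow> bool" where
  "clique M g \<longleftrightarrow> g ` {..l} \<subseteq> univ M \<and> (\<forall>xs\<in>clique_lists. map g xs \<in> rel M 1)"

lemma one_in_vocabulary: "1 \<in> {1..\<rho>}"
  using rho_pos by simp

text \<open>One of the indices \<open>0\<close>, \<open>1\<close> is outside \<open>{i, j}\<close>.
  The other \<open>l\<close> indices leave room for a list of \<open>r 1\<close> of them through
  \<open>i\<close> and \<open>j\<close>, because \<open>2 \<le> r 1 \<le> l\<close>, and this list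
  yields a tuple of the relation.\<close>

lemma clique_colours_neq:
  assumes "strong_colouring l M \<delta>" "clique M g" "i \<noteq> j" "i \<le> l" "j \<le> l" "{i, j} \<noteq> {0, 1}"
  shows "\<delta> (g i) \<noteq> \<delta> (g j)"
proof -
  obtain e :: nat where e: "e \<in> {0, 1}" "i \<noteq> e" "j \<noteq> e"
  proof (cases "i = 0 \<or> j = 0")
    case True
    then have "i \<noteq> 1" "j \<noteq> 1" using assms(3,6) by auto
    then show thesis by (intro that[of 1]) auto
  next
    case False
    then show thesis by (intro that[of 0]) auto
  qed
  let ?C = "{..l} - {e}"
  have "e \<in> {..l}" using e(1) two_le_l by auto
  then have C: "card ?C = l" by simp
  have "{i, j} \<subseteq> ?C" "card {i, j} \<le> r 1" "r 1 \<le> card ?C"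
    using assms(3-5) e two_le_arity[OF one_in_vocabulary] arity_le_l[OF one_in_vocabulary] C by auto
  then obtain A where A: "{i, j} \<subseteq> A" "A \<subseteq> ?C" "card A = r 1"
    using exists_subset_between[of "{i, j}" "r 1" ?C] by auto
  then obtain xs where xs: "set xs = A" "distinct xs"
    using finite_distinct_list finite_subset by (metis finite_Diff finite_atMost)
  then have "xs \<in> clique_lists" using A e(1) by (auto simp: clique_lists_def distinct_card)
  then have R: "map g xs \<in> rel M 1" using assms(2) by (simp add: clique_def)
  have "i \<in> set xs" "j \<in> set xs" using A(1) xs(1) by auto
  then obtain p q where pq: "p < length xs" "xs ! p = i" "q < length xs" "xs ! q = j"
    unfolding in_set_conv_nth by blast
  have "\<delta> (y ! p) \<noteq> \<delta> (y ! q)" if "y \<in> rel M k" "p < length y" "q < length y" "p \<noteq> q" for y k p q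
    using assms(1) that unfolding strong_colouring_def by blast
  from this[OF R, of p q] show ?thesis using pq assms(3) by auto
qed

text \<open>Otherwise \<open>l + 1\<close> indices would carry pairwise different colours from
  \<open>{1..l}\<close>.\<close>

lemma clique_colours_eq:
  assumes "strong_colouring l M \<delta>" "clique M g"
  shows "\<delta> (g 0) = \<delta> (g 1)"
proof (rule ccontr)
  assume neq: "\<delta> (g 0) \<noteq> \<delta> (g 1)"
  have "inj_on (\<lambda>i. \<delta> (g i)) {..l}"
  proof (rule inj_onI, rule ccontr)
    fix i j assume ij: "i \<in> {..l}" "j \<in> {..l}" "\<delta> (g i) = \<delta> (g j)" "i \<noteq> j"
    show False
    proof (cases "{i, j} = {0, 1}")
      case True
      then show False using ij(3,4) neq by (auto simp: doubleton_eq_iff)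
    next
      case False
      then show False using clique_colours_neq[OF assms ij(4)] ij by simp
    qed
  qed
  moreover have "(\<lambda>i. \<delta> (g i)) ` {..l} \<subseteq> {1..l}"
    using assms unfolding strong_colouring_def clique_def by blast
  ultimately have "card {..l} \<le> card {1..l}" by (intro card_inj_on_le) auto
  then show False by simp
qed

text \<open>The vertices \<open>g 2, ..., g l\<close> are found one by one. As \<open>a\<close> and
  \<open>b\<close> share a colour, \<open>g 0, ..., g m\<close> use at most \<open>m < l\<close>
  colours; the next vertex takes a free colour and the pattern in which every slot is present. At
  most \<open>l\<close> vertices are in use before each step, hence the assumption
  \<open>l < t\<close>.\<close>

lemma clique_exists:
  assumes sat: "saturated t \<gamma> V W" and t: "l < t" and ab: "a \<in> V" "b \<in> V" "\<gamma> a = \<gamma> b"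
  obtains g where "clique (struc V W) g" "g 0 = a" "g 1 = b"
proof -
  note S = saturatedD[OF sat]
  have "\<exists>g. g 0 = a \<and> g 1 = b \<and> g ` {..m} \<subseteq> V \<and>
      (\<forall>i\<le>m. \<forall>j\<le>m. i \<noteq> j \<longrightarrow> {i, j} \<noteq> {0, 1} \<longrightarrow> \<gamma> (g i) \<noteq> \<gamma> (g j)) \<and>
      (\<forall>xs\<in>clique_lists. set xs \<subseteq> {..m} \<longrightarrow> map g xs \<in> rel (struc V W) 1)"
    if "1 \<le> m" "m \<le> l" for m
    using that
  proof (induction m rule: dec_induct)
    case base
    have no: "\<not> set xs \<subseteq> {..1}" if "xs \<in> clique_lists" for xs
    proof
      assume "set xs \<subseteq> {..1}"
      then have "set xs \<subseteq> {0} \<or> set xs \<subseteq> {1}"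
        using that by (auto simp: clique_lists_def atMost_Suc)
      then have "card (set xs) \<le> 1" by (elim disjE) (auto dest: card_mono[rotated])
      then show False
        using that two_le_arity[OF one_in_vocabulary] by (auto simp: clique_lists_def distinct_card)
    qed
    have two: "{i, j} = {0, 1}" if "i \<le> 1" "j \<le> 1" "i \<noteq> j" for i j :: nat using that by auto
    let ?g = "\<lambda>i :: nat. if i = 0 then a else b"
    have "?g 0 = a" "?g 1 = b" "?g ` {..1} \<subseteq> V" using ab by auto
    then show ?case using no two by (intro exI[of _ ?g]) blast
  next
    case (step m)
    then obtain g where g: "g 0 = a" "g 1 = b" "g ` {..m} \<subseteq> V"
      "\<And>i j. i \<le> m \<Longrightarrow> j \<le> m \<Longrightarrow> i \<noteq> j \<Longrightarrow> {i, j} \<noteq> {0, 1} \<Longrightarrow> \<gamma> (g i) \<noteq> \<gamma> (g j)"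
      "\<And>xs. xs \<in> clique_lists \<Longrightarrow> set xs \<subseteq> {..m} \<Longrightarrow> map g xs \<in> rel (struc V W) 1"
      by auto
    let ?X = "g ` {..m}"
    have "card ?X \<le> Suc m" using card_image_le[of "{..m}" g] by simp
    then have X: "card ?X < t" using step t by simp
    have "\<gamma> ` ?X \<subseteq> (\<lambda>i. \<gamma> (g i)) ` ({..m} - {1})"
    proof
      fix c assume "c \<in> \<gamma> ` ?X"
      then obtain i where i: "i \<le> m" "c = \<gamma> (g i)" by auto
      show "c \<in> (\<lambda>i. \<gamma> (g i)) ` ({..m} - {1})"
      proof (cases "i = 1")
        case True
        then have "c = \<gamma> (g 0)" using i ab g by simp
        then show ?thesis by (intro image_eqI[of _ _ 0]) auto
      qed (use i in auto)
    qed
    then have "card (\<gamma> ` ?X) \<le> card ({..m} - {1})" by (intro surj_card_le) auto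
    also have "\<dots> = m" using step by simp
    finally have "card (\<gamma> ` ?X) < card {1..l}" using step by simp
    then have "\<not> {1..l} \<subseteq> \<gamma> ` ?X" using card_mono[of "\<gamma> ` ?X" "{1..l}"] by auto
    then obtain c where c: "c \<in> {1..l}" "c \<notin> \<gamma> ` ?X" by blast
    obtain d where d: "d \<in> V - ?X" "\<gamma> d = c"
      "\<forall>q\<in>pat (\<gamma>(0 := c)) ?X 0. kmap (id(0 := d)) q \<in> W \<longleftrightarrow> q \<in> UNIV"
      by (rule extD[OF S(5) g(3) X c(1), where Q = UNIV])
    let ?g = "g(Suc m := d)"
    have neq: "\<gamma> (?g i) \<noteq> \<gamma> (?g j)"
      if ij: "i \<le> Suc m" "j \<le> Suc m" "i \<noteq> j" "{i, j} \<noteq> {0, 1}" for i j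
    proof -
      have *: "\<gamma> (g k) \<noteq> c" if "k \<le> m" for k using c(2) that by auto
      consider "i \<le> m" "j \<le> m" | "i = Suc m" "j \<le> m" | "j = Suc m" "i \<le> m" using ij by linarith
      then show ?thesis using g(4)[OF _ _ ij(3,4)] *[of i] *[of j] d(2) by cases auto
    qed
    have R: "map ?g xs \<in> rel (struc V W) 1" if xs: "xs \<in> clique_lists" "set xs \<subseteq> {..Suc m}" for xs
    proof (cases "Suc m \<in> set xs")
      case False
      then have "set xs \<subseteq> {..m}" using xs(2) by (auto simp: atMost_Suc)
      then have "map g xs \<in> rel (struc V W) 1" by (rule g(5)[OF xs(1)])
      moreover have "map ?g xs = map g xs" using False by auto
      ultimately show ?thesis by (simp only:)
    next
      case True
      \<comment> \<open>The tuple with the new vertex replaced by the placeholder. The other entries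
        differ from \<open>0\<close> since \<open>0 \<notin> V\<close>, so substituting
        \<open>d\<close> for \<open>0\<close> gives back the tuple.\<close>
      let ?ys = "map (g(Suc m := 0)) xs"
      have dist: "distinct xs" "length xs = r 1" "\<not> {0, 1} \<subseteq> set xs"
        using xs(1) by (auto simp: clique_lists_def)
      have g0: "g i \<noteq> 0" if "i \<in> set xs" "i \<noteq> Suc m" for i
      proof -
        have "i \<in> {..m}" using that xs(2) by (auto simp: atMost_Suc)
        then have "g i \<in> V" using g(3) by blast
        then show ?thesis using S(2) by metis
      qed
      have m1: "map (\<gamma>(0 := c)) ?ys = map \<gamma> (map ?g xs)" and m2: "map (id(0 := d)) ?ys = map ?g xs"
        using d(2) by (auto dest: g0)
      have inj: "inj_on (\<lambda>i. \<gamma> (?g i)) (set xs)"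
      proof (rule inj_onI, rule ccontr)
        fix i j assume ij: "i \<in> set xs" "j \<in> set xs" "\<gamma> (?g i) = \<gamma> (?g j)" "i \<noteq> j"
        have le: "i \<le> Suc m" "j \<le> Suc m" using ij(1,2) xs(2) by auto
        have "{i, j} \<subseteq> set xs" using ij(1,2) by simp
        then have "{i, j} \<noteq> {0, 1}" using dist(3) by metis
        from neq[OF le ij(4) this] ij(3) show False by (rule notE)
      qed
      have "distinct (map \<gamma> (map ?g xs))"
        unfolding map_map comp_def by (simp only: distinct_map dist(1) inj simp_thms)
      moreover from this have dg: "distinct (map ?g xs)"
        by (rule distinct_map[THEN iffD1, THEN conjunct1])
      moreover have "set ?ys \<subseteq> insert 0 ?X" using xs(2) by (auto simp: atMost_Suc)
      moreover have "0 \<in> set ?ys" using True by force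
      ultimately have "?ys \<in> {ys \<in> rainbow (\<gamma>(0 := c)) (insert 0 ?X) 1. 0 \<in> set ys}"
        unfolding rainbow_def m1 mem_Collect_eq by (simp only: length_map dist(2) simp_thms)
      then have "key 1 ?ys \<in> pat (\<gamma>(0 := c)) ?X 0"
        using one_in_vocabulary unfolding pat_def by blast
      then have "key 1 (map ?g xs) \<in> W" using bspec[OF d(3)] unfolding m2[symmetric] key_map by simp
      then show ?thesis using dg by simp
    qed
    have "?g 0 = a" "?g 1 = b" "?g ` {..Suc m} \<subseteq> V"
      using g(1-3) d(1) step.hyps by (auto simp: atMost_Suc)
    then show ?case using neq R by (intro exI[of _ ?g] conjI allI impI ballI)
  qed
  note ex = this
  have "1 \<le> l" using two_le_l by simp
  from ex[OF this order_refl] obtain g where g: "g 0 = a" "g 1 = b" "g ` {..l} \<subseteq> V"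
      "\<forall>xs\<in>clique_lists. set xs \<subseteq> {..l} \<longrightarrow> map g xs \<in> rel (struc V W) 1"
    by blast
  have "clique (struc V W) g"
    unfolding clique_def using g(3,4) by (simp add: clique_lists_def del: rel_struc)
  then show thesis using g(1,2) by (rule that)
qed

lemma saturated_colouring:
  assumes "saturated t \<gamma> V W" "V \<noteq> {}"
  shows "strong_colouring l (struc V W) \<gamma>"
  using struc_in_coloured_structures[OF assms(2)] saturatedD[OF assms(1)]
  by (auto simp: coloured_structures_def)

text \<open>Vertices of equal \<open>\<gamma>\<close>-colour are the ends of a clique, which forces
  equal \<open>\<delta>\<close>-colours. Conversely, if \<open>\<delta>\<close> merged the classes
  of \<open>a\<close> and \<open>b\<close>, a clique through \<open>a\<close> would meet the class
  of \<open>b\<close> in a vertex that \<open>\<delta>\<close> must separate from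
  \<open>a\<close>.\<close>

lemma saturated_unique:
  assumes sat: "saturated t \<gamma> V W" and t: "l < t" and ab: "a \<in> V" "b \<in> V"
    and \<delta>: "strong_colouring l (struc V W) \<delta>"
  shows "\<delta> a = \<delta> b \<longleftrightarrow> \<gamma> a = \<gamma> b"
proof
  have same: "\<delta> x = \<delta> y" if xy: "x \<in> V" "y \<in> V" "\<gamma> x = \<gamma> y" for x y
  proof -
    obtain g where "clique (struc V W) g" "g 0 = x" "g 1 = y" by (rule clique_exists[OF sat t xy])
    then show ?thesis using clique_colours_eq[OF \<delta>] by metis
  qed
  then show "\<gamma> a = \<gamma> b \<Longrightarrow> \<delta> a = \<delta> b" using ab by blast
  assume eq: "\<delta> a = \<delta> b"
  show "\<gamma> a = \<gamma> b"
  proof (rule ccontr)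
    assume neq: "\<gamma> a \<noteq> \<gamma> b"
    \<comment> \<open>With both ends at \<open>a\<close>, the \<open>l\<close> indices other than
      \<open>1\<close> have different \<open>\<gamma>\<close>-colours, so every colour occurs, that
      of \<open>b\<close> at some \<open>i \<noteq> 0\<close>.\<close>
    obtain g where g: "clique (struc V W) g" "g 0 = a" "g 1 = a"
      by (rule clique_exists[OF sat t ab(1) ab(1) refl])
    have \<gamma>: "strong_colouring l (struc V W) \<gamma>"
      by (rule saturated_colouring[OF sat]) (use ab(1) in blast)
    have "g ` {..l} \<subseteq> V" using g(1) by (simp add: clique_def)
    then have gV: "g i \<in> V" if "i \<le> l" for i using that by blast
    let ?J = "{..l} - {1}"
    have "inj_on (\<lambda>i. \<gamma> (g i)) ?J"
    proof (rule inj_onI, rule ccontr)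
      fix i j assume ij: "i \<in> ?J" "j \<in> ?J" "\<gamma> (g i) = \<gamma> (g j)" "i \<noteq> j"
      have "1 \<notin> {i, j}" using ij(1,2) by blast
      then have "{i, j} \<noteq> {0, 1}" by blast
      then show False using clique_colours_neq[OF \<gamma> g(1) ij(4)] ij(1-3) by simp
    qed
    moreover have "(\<lambda>i. \<gamma> (g i)) ` ?J \<subseteq> {1..l}"
      using gV saturatedD(3)[OF sat] by (intro image_subsetI) (auto dest!: funcset_mem)
    moreover have "card ?J = card {1..l}" using two_le_l by simp
    ultimately have "(\<lambda>i. \<gamma> (g i)) ` ?J = {1..l}"
      by (intro card_subset_eq) (simp_all add: card_image)
    moreover have "\<gamma> b \<in> {1..l}" using saturatedD(3)[OF sat] ab(2) by blast
    ultimately have "\<gamma> b \<in> (\<lambda>i. \<gamma> (g i)) ` ?J" by (simp only:)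
    then obtain i where i: "i \<in> ?J" "\<gamma> b = \<gamma> (g i)" by (rule imageE)
    have "i \<noteq> 0" using neq g(2) i(2) by metis
    have "1 \<notin> {i, 0}" "i \<le> l" using i(1) by auto
    then have "{i, 0} \<noteq> {0, 1}" by blast
    then have "\<delta> (g i) \<noteq> \<delta> (g 0)" using clique_colours_neq[OF \<delta> g(1) \<open>i \<noteq> 0\<close>] \<open>i \<le> l\<close> by simp
    moreover have "\<delta> (g i) = \<delta> b" using same[OF gV ab(2)] i \<open>i \<le> l\<close> by simp
    ultimately show False using eq g(2) by simp
  qed
qed

end

section \<open>Expressing cliques by a formula\<close>

lemma formula_foldr_Ex: "formula \<rho> r (foldr Ex xs \<phi>) \<longleftrightarrow> formula \<rho> r \<phi>"
  by (induction xs) auto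

lemma free_vars_foldr_Ex: "free_vars (foldr Ex xs \<phi>) = free_vars \<phi> - set xs"
  by (induction xs) auto

lemma sat_foldr_Ex:
  "sat M v (foldr Ex xs \<phi>) \<longleftrightarrow>
     (\<exists>w. (\<forall>y. y \<notin> set xs \<longrightarrow> w y = v y) \<and> (\<forall>y\<in>set xs. w y \<in> univ M) \<and> sat M w \<phi>)"
proof (induction xs arbitrary: v)
  case Nil
  have "(\<forall>y. w y = v y) \<longleftrightarrow> w = v" for w by auto
  then show ?case by simp
next
  case (Cons x xs)
  \<comment> \<open>\<open>x\<close> may recur in \<open>xs\<close>, in which case the value
    \<open>a\<close> is overwritten; in either case \<open>w x\<close> is in the universe and can
    serve as \<open>a\<close>.\<close>
  have eq: "(\<exists>a\<in>univ M. \<forall>y. y \<notin> set xs \<longrightarrow> w y = (v(x := a)) y) \<and> (\<forall>y\<in>set xs. w y \<in> univ M) \<longleftrightarrow>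
      (\<forall>y. y \<notin> set (x # xs) \<longrightarrow> w y = v y) \<and> (\<forall>y\<in>set (x # xs). w y \<in> univ M)" (is "?L \<longleftrightarrow> ?R") for w
  proof
    assume ?L
    then obtain a where a: "a \<in> univ M" "\<And>y. y \<notin> set xs \<Longrightarrow> w y = (v(x := a)) y"
      "\<And>y. y \<in> set xs \<Longrightarrow> w y \<in> univ M" by blast
    have "w x \<in> univ M" using a by (cases "x \<in> set xs") simp_all
    then show ?R using a(2,3) by simp
  next
    assume R: ?R
    then have "\<forall>y. y \<notin> set xs \<longrightarrow> w y = (v(x := w x)) y" by simp
    moreover have "w x \<in> univ M" using R by simp
    moreover have "\<forall>y\<in>set xs. w y \<in> univ M" using R by simp
    ultimately show ?L by blast
  qed
  have "sat M v (foldr Ex (x # xs) \<phi>) \<longleftrightarrow> (\<exists>a\<in>univ M. \<exists>w.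
      (\<forall>y. y \<notin> set xs \<longrightarrow> w y = (v(x := a)) y) \<and> (\<forall>y\<in>set xs. w y \<in> univ M) \<and> sat M w \<phi>)"
    unfolding foldr.simps comp_def sat.simps Cons.IH ..
  also have "\<dots> \<longleftrightarrow> (\<exists>w. ((\<exists>a\<in>univ M. \<forall>y. y \<notin> set xs \<longrightarrow> w y = (v(x := a)) y) \<and>
      (\<forall>y\<in>set xs. w y \<in> univ M)) \<and> sat M w \<phi>)" (is "?L \<longleftrightarrow> ?R")
  proof
    assume ?L
    then show ?R by (elim bexE exE conjE) (intro exI conjI bexI)
  next
    assume ?R
    then show ?L by (elim bexE exE conjE) (intro exI conjI bexI)
  qed
  also have "\<dots> \<longleftrightarrow> (\<exists>w. (\<forall>y. y \<notin> set (x # xs) \<longrightarrow> w y = v y) \<and>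
      (\<forall>y\<in>set (x # xs). w y \<in> univ M) \<and> sat M w \<phi>)"
    unfolding eq conj_assoc ..
  finally show ?case .
qed

lemma foldr_Conj:
  "formula \<rho> r (foldr Conj \<phi>s \<psi>) \<longleftrightarrow> (\<forall>\<phi>\<in>set \<phi>s. formula \<rho> r \<phi>) \<and> formula \<rho> r \<psi>"
  "free_vars (foldr Conj \<phi>s \<psi>) = (\<Union>\<phi>\<in>set \<phi>s. free_vars \<phi>) \<union> free_vars \<psi>"
  "sat M v (foldr Conj \<phi>s \<psi>) \<longleftrightarrow> (\<forall>\<phi>\<in>set \<phi>s. sat M v \<phi>) \<and> sat M v \<psi>"
  by (induction \<phi>s) auto

context vocabulary
begin

text \<open>The variables are the indices of \<open>g\<close>: \<open>\<xi>\<close> quantifies those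
  from \<open>2\<close> to \<open>l\<close> and states the finitely many memberships given by
  \<open>clique_lists\<close>. \<open>Eq 0 0\<close> only closes the conjunction.\<close>

lemma clique_formula:
  obtains \<xi> where "formula \<rho> r \<xi>" "free_vars \<xi> \<subseteq> {0, 1}"
    "\<And>(M :: 'a rel_struct) a b. a \<in> univ M \<Longrightarrow> b \<in> univ M \<Longrightarrow>
       models_at M \<xi> a b \<longleftrightarrow> (\<exists>g. clique M g \<and> g 0 = a \<and> g 1 = b)"
proof -
  have "clique_lists \<subseteq> {xs. set xs \<subseteq> {..l} \<and> length xs = r 1}" by (auto simp: clique_lists_def)
  then have "finite clique_lists"
    using finite_lists_length_eq[of "{..l}" "r 1"] finite_subset by blast
  then obtain Ls where Ls: "set Ls = clique_lists" using finite_list by blast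
  define \<xi> where "\<xi> = foldr Ex [2..<Suc l] (foldr Conj (map (Rel 1) Ls) (Eq 0 0))"
  have "formula \<rho> r \<xi>"
    using one_in_vocabulary Ls by (auto simp: \<xi>_def formula_foldr_Ex foldr_Conj clique_lists_def)
  moreover have "free_vars \<xi> \<subseteq> {0, 1}"
  proof
    fix x assume "x \<in> free_vars \<xi>"
    then have "x \<le> l" "x \<notin> {2..<Suc l}"
      unfolding \<xi>_def free_vars_foldr_Ex foldr_Conj using Ls by (auto simp: clique_lists_def)
    then show "x \<in> {0, 1}" by auto
  qed
  moreover have "models_at M \<xi> a b \<longleftrightarrow> (\<exists>g. clique M g \<and> g 0 = a \<and> g 1 = b)"
    if ab: "a \<in> univ M" "b \<in> univ M" for M :: "'a rel_struct" and a b
  proof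
    assume "models_at M \<xi> a b"
    then obtain w where w: "\<forall>y. y \<notin> set [2..<Suc l] \<longrightarrow> w y = ((\<lambda>_. a)(1 := b)) y"
      "\<forall>y\<in>set [2..<Suc l]. w y \<in> univ M" "\<forall>xs\<in>clique_lists. map w xs \<in> rel M 1"
      unfolding models_at_def \<xi>_def sat_foldr_Ex foldr_Conj using Ls by auto
    have w01: "w 0 = a" "w 1 = b" using w(1) by auto
    have "w i \<in> univ M" if "i \<le> l" for i
    proof -
      have "i = 0 \<or> i = 1 \<or> i \<in> set [2..<Suc l]" using that by auto
      then show ?thesis using w01 w(2) ab by metis
    qed
    then have "clique M w" using w(3) by (auto simp: clique_def)
    then show "\<exists>g. clique M g \<and> g 0 = a \<and> g 1 = b" using w01 by blast
  next
    assume "\<exists>g. clique M g \<and> g 0 = a \<and> g 1 = b"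
    then obtain g where g: "clique M g" "g 0 = a" "g 1 = b" by blast
    \<comment> \<open>Beyond \<open>l\<close> the assignment has to agree with the one in
      \<open>models_at\<close>, whose default value is \<open>a\<close>.\<close>
    define w where "w = (\<lambda>y. if y \<le> l then g y else a)"
    have same: "map w xs = map g xs" if "xs \<in> clique_lists" for xs
      using that by (auto simp: w_def clique_lists_def)
    have "\<forall>xs\<in>set Ls. map w xs \<in> rel M 1"
    proof
      fix xs assume "xs \<in> set Ls"
      then show "map w xs \<in> rel M 1" using g(1) unfolding Ls clique_def by (simp only: same)
    qed
    moreover have "w y = ((\<lambda>_. a)(1 := b)) y" if "y \<notin> set [2..<Suc l]" for y
    proof -
      have "y = 0 \<or> y = 1 \<or> \<not> y \<le> l \<and> y \<noteq> 1" using that two_le_l by auto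
      then show ?thesis using g two_le_l by (elim disjE) (auto simp: w_def)
    qed
    moreover have "\<forall>y\<in>set [2..<Suc l]. w y \<in> univ M"
      using g(1) by (auto simp: w_def clique_def)
    ultimately show "models_at M \<xi> a b"
      unfolding models_at_def \<xi>_def sat_foldr_Ex foldr_Conj by (intro exI[of _ w]) auto
  qed
  ultimately show thesis by (rule that)
qed

end

section \<open>Limits and proportions\<close>

text \<open>Rounding and truncated subtraction make the exponent at most \<open>1 + t\<close>
  smaller than \<open>n / d\<close>, which costs a constant factor of the exponential decay.\<close>

lemma tendsto_poly_times_power_div:
  fixes q :: real and d k t :: nat
  assumes "0 < q" "q < 1" "0 < d"
  shows "(\<lambda>n. (real n + 1) ^ k * q ^ (n div d - t)) \<longlonglongrightarrow> 0"
proof -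
  define s where "s = - ln q"
  have s: "0 < s" "q = exp (- s)" using assms(1,2) by (simp_all add: s_def)
  have "q ^ (n div d - t) \<le> exp (- s * (real n / real d - (1 + real t)))" for n
  proof -
    have "real n < real (d + n div d * d)"
      using dividend_less_div_times[OF assms(3)] by (rule of_nat_less_iff[THEN iffD2])
    then have "real n / real d - 1 \<le> real (n div d)"
      using assms(3) by (simp add: field_simps)
    then have "real n / real d - (1 + real t) \<le> real (n div d - t)" by linarith
    then have "- s * real (n div d - t) \<le> - s * (real n / real d - (1 + real t))"
      using s(1) by simp
    then have "exp (real (n div d - t) * (- s)) \<le> exp (- s * (real n / real d - (1 + real t)))"
      unfolding exp_le_cancel_iff by (simp only: mult.commute)
    then show ?thesis unfolding exp_of_nat_mult s(2) .
  qed
  then have le: "(real n + 1) ^ k * q ^ (n div d - t) \<le>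
      (real n + 1) ^ k * exp (- s * (real n / real d - (1 + real t)))" for n
    by (intro mult_left_mono) auto
  have lim: "(\<lambda>n. (real n + 1) ^ k * exp (- s * (real n / a - b))) \<longlonglongrightarrow> 0"
    if "0 < s" "0 < a" for s a b :: real
    using that by real_asymp
  have "(\<lambda>n. (real n + 1) ^ k * exp (- s * (real n / real d - (1 + real t)))) \<longlonglongrightarrow> 0"
    by (rule lim) (use s(1) assms(3) in simp_all)
  then show ?thesis
  proof (rule tendsto_sandwich[OF _ _ tendsto_const, rotated 2])
    show "\<forall>\<^sub>F n in sequentially. 0 \<le> (real n + 1) ^ k * q ^ (n div d - t)"
      using assms(1) by (intro always_eventually allI) simp
    show "\<forall>\<^sub>F n in sequentially. (real n + 1) ^ k * q ^ (n div d - t) \<le>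
        (real n + 1) ^ k * exp (- s * (real n / real d - (1 + real t)))"
      by (intro always_eventually allI le)
  qed
qed

text \<open>Asking for the implication at positive \<open>n\<close> only does not affect the limit
  and allows later arguments to rely on a nonempty universe.\<close>

lemma almost_all_mono:
  assumes P: "almost_all S P" and fin: "\<And>n. finite (S n)"
    and PQ: "\<And>n M. 0 < n \<Longrightarrow> M \<in> S n \<Longrightarrow> P M \<Longrightarrow> Q M"
  shows "almost_all S Q"
  unfolding almost_all_def
proof (rule tendsto_sandwich)
  show "(\<lambda>n. real (card {M \<in> S n. P M}) / real (card (S n))) \<longlonglongrightarrow> 1"
    using P by (simp add: almost_all_def)
  show "\<forall>\<^sub>F n in sequentially. real (card {M \<in> S n. P M}) / real (card (S n))
      \<le> real (card {M \<in> S n. Q M}) / real (card (S n))"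
    using eventually_gt_at_top[of 0]
  proof eventually_elim
    case (elim n)
    then have "{M \<in> S n. P M} \<subseteq> {M \<in> S n. Q M}" using PQ by blast
    then have "card {M \<in> S n. P M} \<le> card {M \<in> S n. Q M}" using fin by (intro card_mono) simp_all
    then show ?case by (intro divide_right_mono) simp_all
  qed
  have "real (card {M \<in> S n. Q M}) / real (card (S n)) \<le> 1" for n
  proof -
    have "card {M \<in> S n. Q M} \<le> card (S n)" using fin by (intro card_mono) auto
    then show ?thesis by (intro divide_le_eq_1[THEN iffD2]) linarith
  qed
  then show "\<forall>\<^sub>F n in sequentially. real (card {M \<in> S n. Q M}) / real (card (S n)) \<le> 1"
    by simp
qed simp

context vocabulary
begin

lemma error_tendsto_0:
  assumes "0 < t"
  shows "error t \<longlonglongrightarrow> 0"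
proof -
  let ?m = "\<rho> * t ^ l" and ?q = "\<lambda>m. 1 - 1 / 2 ^ m :: real"
  have m: "0 < ?m" using assms rho_pos by simp
  then have "(2 :: real) ^ 1 \<le> 2 ^ ?m" by (intro power_increasing) auto
  then have q: "0 < ?q ?m" "?q ?m < 1" by (simp_all add: field_simps)
  have l: "0 < real l" "0 < 4 * l" "0 < 2 * l" using two_le_l by simp_all
  have "(\<lambda>n. (real n + 1) ^ 1 * (1 / 2) ^ (n div (2 * l) - 0)) \<longlonglongrightarrow> 0"
    using l by (intro tendsto_poly_times_power_div) auto
  then have 1: "(\<lambda>n. real n * (1 / 2) ^ (n div (2 * l))) \<longlonglongrightarrow> 0"
    by (rule tendsto_sandwich[OF _ _ tendsto_const, rotated 2])
      (auto intro!: always_eventually mult_right_mono)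
  have "real n * l / 2 ^ (n div (2 * l)) = real l * (real n * (1 / 2) ^ (n div (2 * l)))" for n
    by (simp add: power_one_over field_simps)
  then have A: "(\<lambda>n. real n * l / 2 ^ (n div (2 * l))) \<longlonglongrightarrow> 0"
    using tendsto_mult_right_zero[OF 1, of "real l"] by simp
  have "(\<lambda>n. (real (l - 1) / l) ^ n) \<longlonglongrightarrow> 0"
    using l(1) by (intro LIMSEQ_power_zero) simp
  then have B: "(\<lambda>n. l * (real (l - 1) / l) ^ n) \<longlonglongrightarrow> 0" by (rule tendsto_mult_right_zero)
  have "(\<lambda>n. (real l * 2 ^ ?m) * ((real n + 1) ^ t * ?q ?m ^ (n div (4 * l) - t))) \<longlonglongrightarrow> 0"
    by (intro tendsto_mult_right_zero tendsto_poly_times_power_div q l)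
  then have C: "(\<lambda>n. (real n + 1) ^ t * l * 2 ^ ?m * ?q ?m ^ (n div (4 * l) - t)) \<longlonglongrightarrow> 0"
    by (simp add: mult_ac)
  show ?thesis using tendsto_add[OF tendsto_add[OF A B] C] unfolding error_def by simp
qed

section \<open>Back and forth\<close>

text \<open>\<open>D\<close> holds the variables whose values are compared. Colours belong to the
  invariant, although no formula mentions them, because they determine which slots a further vertex
  can have with the present ones.\<close>

definition back_and_forth ::
    "(nat \<Rightarrow> nat) \<Rightarrow> nat set \<Rightarrow> (nat \<times> (nat list + nat set)) set \<Rightarrow>
     (nat \<Rightarrow> nat) \<Rightarrow> nat set \<Rightarrow> (nat \<times> (nat list + nat set)) set \<Rightarrow>
     nat set \<Rightarrow> (nat \<Rightarrow> nat) \<Rightarrow> (nat \<Rightarrow> nat) \<Rightarrow> bool" where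
  "back_and_forth \<gamma> V W \<delta> U Z D v w \<longleftrightarrow>
     v ` D \<subseteq> V \<and> w ` D \<subseteq> U \<and> (\<forall>x\<in>D. \<gamma> (v x) = \<delta> (w x)) \<and>
     (\<forall>x\<in>D. \<forall>y\<in>D. v x = v y \<longleftrightarrow> w x = w y) \<and>
     (\<forall>k xs. set xs \<subseteq> D \<longrightarrow> (map v xs \<in> rel (struc V W) k \<longleftrightarrow> map w xs \<in> rel (struc U Z) k))"

lemma back_and_forth_sym:
  "back_and_forth \<gamma> V W \<delta> U Z D v w \<Longrightarrow> back_and_forth \<delta> U Z \<gamma> V W D w v"
  unfolding back_and_forth_def by (simp del: rel_struc)

lemma back_and_forthD:
  assumes "back_and_forth \<gamma> V W \<delta> U Z D v w"
  shows "v ` D \<subseteq> V" "w ` D \<subseteq> U" "\<And>x. x \<in> D \<Longrightarrow> \<gamma> (v x) = \<delta> (w x)"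
    "\<And>x y. x \<in> D \<Longrightarrow> y \<in> D \<Longrightarrow> v x = v y \<longleftrightarrow> w x = w y"
    "\<And>k xs. set xs \<subseteq> D \<Longrightarrow> map v xs \<in> rel (struc V W) k \<longleftrightarrow> map w xs \<in> rel (struc U Z) k"
proof -
  note bf = assms[unfolded back_and_forth_def]
  show "v ` D \<subseteq> V" by (rule bf[THEN conjunct1])
  show "w ` D \<subseteq> U" by (rule bf[THEN conjunct2, THEN conjunct1])
  show "\<gamma> (v x) = \<delta> (w x)" if "x \<in> D" for x
    by (rule bf[THEN conjunct2, THEN conjunct2, THEN conjunct1, THEN bspec, OF that])
  show "v x = v y \<longleftrightarrow> w x = w y" if "x \<in> D" "y \<in> D" for x y
    by (rule bf[THEN conjunct2, THEN conjunct2, THEN conjunct2, THEN conjunct1, THEN bspec, THEN bspec, OF that])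
  show "map v xs \<in> rel (struc V W) k \<longleftrightarrow> map w xs \<in> rel (struc U Z) k" if "set xs \<subseteq> D" for k xs
    by (rule bf[THEN conjunct2, THEN conjunct2, THEN conjunct2, THEN conjunct2, rule_format, OF that])
qed

lemma back_and_forth_subset:
  assumes bf: "back_and_forth \<gamma> V W \<delta> U Z D v w" and sub: "D' \<subseteq> D"
  shows "back_and_forth \<gamma> V W \<delta> U Z D' v w"
proof -
  note bf = back_and_forthD[OF bf]
  have D: "x \<in> D" if "x \<in> D'" for x using sub that by blast
  show ?thesis
    unfolding back_and_forth_def
  proof (intro conjI ballI allI impI)
    show "v ` D' \<subseteq> V" by (rule subset_trans[OF image_mono[OF sub] bf(1)])
    show "w ` D' \<subseteq> U" by (rule subset_trans[OF image_mono[OF sub] bf(2)])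
    show "\<gamma> (v x) = \<delta> (w x)" if "x \<in> D'" for x by (rule bf(3)[OF D[OF that]])
    show "v x = v y \<longleftrightarrow> w x = w y" if "x \<in> D'" "y \<in> D'" for x y
      by (rule bf(4)[OF D[OF that(1)] D[OF that(2)]])
    show "map v xs \<in> rel (struc V W) k \<longleftrightarrow> map w xs \<in> rel (struc U Z) k" if "set xs \<subseteq> D'" for k xs
      by (rule bf(5)[OF subset_trans[OF that sub]])
  qed
qed

text \<open>The forth step; exchanging the structures gives the back step. A new vertex
  \<open>a\<close> is answered by a vertex of the same colour that realizes a copy of the pattern of
  \<open>a\<close>.\<close>

lemma back_and_forth_insert:
  assumes VW: "saturated t \<gamma> V W" and UZ: "saturated t \<delta> U Z"
    and bf: "back_and_forth \<gamma> V W \<delta> U Z D v w"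
    and D: "finite D" "card D < t" "x \<notin> D" and a: "a \<in> V"
  shows "\<exists>b\<in>U. back_and_forth \<gamma> V W \<delta> U Z (insert x D) (v(x := a)) (w(x := b))"
proof -
  note S = saturatedD[OF VW] and T = saturatedD[OF UZ]
  note bfD = back_and_forthD[OF bf]
  show ?thesis
  proof (cases "a \<in> v ` D")
    case True
    then obtain z where z: "z \<in> D" "a = v z" by blast
    \<comment> \<open>\<open>x\<close> becomes a second name for the value of \<open>z\<close>, and
      renaming by \<open>f\<close> reduces every clause to \<open>D\<close>.\<close>
    define f where "f = (\<lambda>y. if y = x then z else y)"
    have v: "(v(x := a)) y = v (f y)" and w: "(w(x := w z)) y = w (f y)" for y
      using z by (auto simp: f_def)
    have fD: "f y \<in> D" if "y \<in> insert x D" for y using that z by (auto simp: f_def)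
    have "back_and_forth \<gamma> V W \<delta> U Z (insert x D) (v(x := a)) (w(x := w z))"
      unfolding back_and_forth_def
    proof (intro conjI ballI allI impI)
      show "(v(x := a)) ` insert x D \<subseteq> V" "(w(x := w z)) ` insert x D \<subseteq> U"
        unfolding v w using fD bfD(1,2) by blast+
      show "\<gamma> ((v(x := a)) y) = \<delta> ((w(x := w z)) y)" if "y \<in> insert x D" for y
        unfolding v w by (rule bfD(3)[OF fD[OF that]])
      show "(v(x := a)) y = (v(x := a)) y' \<longleftrightarrow> (w(x := w z)) y = (w(x := w z)) y'"
        if "y \<in> insert x D" "y' \<in> insert x D" for y y'
        unfolding v w by (rule bfD(4)[OF fD[OF that(1)] fD[OF that(2)]])
      fix k xs assume "set xs \<subseteq> insert x D"
      then have "set (map f xs) \<subseteq> D" using fD by auto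
      moreover have "map (v(x := a)) xs = map v (map f xs)" "map (w(x := w z)) xs = map w (map f xs)"
        unfolding map_map comp_def v[symmetric] w[symmetric] by (rule refl)+
      ultimately show "map (v(x := a)) xs \<in> rel (struc V W) k \<longleftrightarrow>
          map (w(x := w z)) xs \<in> rel (struc U Z) k"
        using bfD(5) by (simp only:)
    qed
    then show ?thesis using bfD(2) z(1) by blast
  next
    case False
    let ?X = "w ` D"
    have cardX: "card ?X < t" using card_image_le[OF D(1), of w] D(2) by simp
    \<comment> \<open>\<open>h\<close> leads from the second structure back to the first and sends
      the placeholder to \<open>a\<close>, so that \<open>{q. kmap h q \<in> W}\<close> is the
      pattern of \<open>a\<close>. The choice made by \<open>inv_into\<close> is harmless, since
      \<open>w x = w y\<close> implies \<open>v x = v y\<close> on \<open>D\<close>.\<close>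
    define h where "h = (\<lambda>z. if z = 0 then a else v (inv_into D w z))"
    have h: "h (w y) = v y" if y: "y \<in> D" for y
    proof -
      have "w y \<in> U" using bfD(2) y by blast
      then have "w y \<noteq> 0" using T(2) by metis
      moreover have "v (inv_into D w (w y)) = v y"
        using bfD(4)[of "inv_into D w (w y)" y] y by (simp add: inv_into_into f_inv_into_f)
      ultimately show ?thesis by (simp add: h_def)
    qed
    have "\<gamma> a \<in> {1..l}" using S(3) a by blast
    then obtain b where b: "b \<in> U - ?X" "\<delta> b = \<gamma> a"
      "\<forall>q\<in>pat (\<delta>(0 := \<gamma> a)) ?X 0. kmap (id(0 := b)) q \<in> Z \<longleftrightarrow> q \<in> {q. kmap h q \<in> W}"
      by (rule extD[OF T(5) bfD(2) cardX, where Q = "{q. kmap h q \<in> W}"])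
    let ?v = "v(x := a)" and ?w = "w(x := b)"
    have col: "\<gamma> (?v y) = \<delta> (?w y)" if "y \<in> insert x D" for y
      using that bfD(3) b(2) D(3) by auto
    have inj: "?v y = ?v y' \<longleftrightarrow> ?w y = ?w y'" if "y \<in> insert x D" "y' \<in> insert x D" for y y'
    proof -
      have *: "a \<noteq> v u" "b \<noteq> w u" if "u \<in> D" for u using False b(1) that by auto
      show ?thesis using that bfD(4)[of y y'] *[of y] *[of y'] *[of y, THEN not_sym] *[of y', THEN not_sym]
        by (cases "y = x"; cases "y' = x") simp_all
    qed
    have R: "map ?v xs \<in> rel (struc V W) k \<longleftrightarrow> map ?w xs \<in> rel (struc U Z) k"
      if xs: "set xs \<subseteq> insert x D" for k xs
    proof (cases "x \<in> set xs")
      case False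
      then have "set xs \<subseteq> D" using xs by blast
      moreover have "map ?v xs = map v xs" "map ?w xs = map w xs" using False by auto
      ultimately show ?thesis using bfD(5) by (simp only:)
    next
      case True
      let ?ys = "map (w(x := 0)) xs"
      have w0: "w y \<noteq> 0" if "y \<in> set xs" "y \<noteq> x" for y
      proof -
        have "y \<in> D" using that xs by blast
        then have "w y \<in> U" using bfD(2) by blast
        then show ?thesis using T(2) by metis
      qed
      have hx: "h (w y) = v y" if "y \<in> set xs" "y \<noteq> x" for y using that xs h by blast
      have h0: "h 0 = a" by (simp add: h_def)
      have m1: "map h ?ys = map ?v xs" using hx h0 by auto
      have m2: "map (id(0 := b)) ?ys = map ?w xs" by (auto dest: w0)
      have m3: "map (\<delta>(0 := \<gamma> a)) ?ys = map \<delta> (map ?w xs)" using b(2) by (auto dest: w0)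
      have m4: "map \<gamma> (map ?v xs) = map \<delta> (map ?w xs)"
        unfolding map_map by (rule map_cong[OF refl]) (use col xs in \<open>auto simp del: fun_upd_apply\<close>)
      show ?thesis
      \<comment> \<open>In the first case the pattern of \<open>b\<close> decides the membership;
        otherwise neither relation can contain the tuple, as the two tuples have the same colours
        and all tuples present are rainbow.\<close>
      proof (cases "k \<in> {1..\<rho>} \<and> length xs = r k \<and> distinct (map \<delta> (map ?w xs))")
        case True
        have "set ?ys \<subseteq> insert 0 ?X" using xs by auto
        moreover have "0 \<in> set ?ys" using \<open>x \<in> set xs\<close> by force
        ultimately have "?ys \<in> {ys \<in> rainbow (\<delta>(0 := \<gamma> a)) (insert 0 ?X) k. 0 \<in> set ys}"
          unfolding rainbow_def m3 mem_Collect_eq using True by (simp only: length_map simp_thms)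
        then have "key k ?ys \<in> pat (\<delta>(0 := \<gamma> a)) ?X 0"
          using True unfolding pat_def by blast
        from bspec[OF b(3) this] have "key k (map ?w xs) \<in> Z \<longleftrightarrow> key k (map ?v xs) \<in> W"
          unfolding mem_Collect_eq key_map[symmetric] m1 m2 .
        moreover have d: "distinct (map \<delta> (map ?w xs))" using True by blast
        then have "distinct (map ?w xs)" by (rule distinct_map[THEN iffD1, THEN conjunct1])
        moreover have "distinct (map \<gamma> (map ?v xs))" unfolding m4 by (rule d)
        then have "distinct (map ?v xs)" by (rule distinct_map[THEN iffD1, THEN conjunct1])
        ultimately show ?thesis unfolding rel_struc mem_Collect_eq by (simp only: simp_thms)
      next
        case False
        have "map ?v xs \<notin> rel (struc V W) k"
        proof
          assume v: "map ?v xs \<in> rel (struc V W) k"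
          note q = rel_struc_subset_rainbow[OF S(4) v]
          have "length xs = r k \<and> distinct (map \<gamma> (map ?v xs))"
            using q(2) unfolding rainbow_def mem_Collect_eq length_map by (elim conjE) (intro conjI)
          then have "k \<in> {1..\<rho>} \<and> length xs = r k \<and> distinct (map \<delta> (map ?w xs))"
            unfolding m4 using q(1) by (intro conjI) simp_all
          with False show False by (rule notE)
        qed
        moreover have "map ?w xs \<notin> rel (struc U Z) k"
        proof
          assume w: "map ?w xs \<in> rel (struc U Z) k"
          note q = rel_struc_subset_rainbow[OF T(4) w]
          have "length xs = r k \<and> distinct (map \<delta> (map ?w xs))"
            using q(2) unfolding rainbow_def mem_Collect_eq length_map by (elim conjE) (intro conjI)
          then have "k \<in> {1..\<rho>} \<and> length xs = r k \<and> distinct (map \<delta> (map ?w xs))"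
            using q(1) by (intro conjI) simp_all
          with False show False by (rule notE)
        qed
        ultimately show ?thesis by (simp only: simp_thms)
      qed
    qed
    have "?v ` insert x D \<subseteq> V" "?w ` insert x D \<subseteq> U" using a b(1) bfD(1,2) D(3) by auto
    then have "back_and_forth \<gamma> V W \<delta> U Z (insert x D) ?v ?w"
      unfolding back_and_forth_def using col inj R by (intro conjI ballI allI impI)
    then show ?thesis using b(1) by blast
  qed
qed

text \<open>\<open>size \<phi>\<close> bounds the nested quantifiers still to come, each of which
  adds at most one vertex; the budget keeps the set used in \<open>ext\<close> below
  \<open>t\<close> vertices.\<close>

lemma sat_iff_if_back_and_forth:
  assumes "saturated t \<gamma> V W" "saturated t \<delta> U Z"
    and "finite D" "card D + size \<phi> \<le> t" "free_vars \<phi> \<subseteq> D"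
    and "back_and_forth \<gamma> V W \<delta> U Z D v w"
  shows "sat (struc V W) v \<phi> \<longleftrightarrow> sat (struc U Z) w \<phi>"
  using assms(3-)
proof (induction \<phi> arbitrary: D v w)
  case (Rel k xs)
  then have "set xs \<subseteq> D" by simp
  then show ?case using Rel.prems(4) unfolding back_and_forth_def sat.simps by blast
next
  case (Eq x y)
  then show ?case unfolding back_and_forth_def by simp
next
  case (Neg \<phi>)
  then show ?case by simp
next
  case (Conj \<phi> \<psi>)
  have "sat (struc V W) v \<phi> \<longleftrightarrow> sat (struc U Z) w \<phi>"
    by (rule Conj.IH(1)[OF Conj.prems(1) _ _ Conj.prems(4)]) (use Conj.prems in auto)
  moreover have "sat (struc V W) v \<psi> \<longleftrightarrow> sat (struc U Z) w \<psi>"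
    by (rule Conj.IH(2)[OF Conj.prems(1) _ _ Conj.prems(4)]) (use Conj.prems in auto)
  ultimately show ?case by simp
next
  case (Ex x \<phi>)
  \<comment> \<open>The quantifier rebinds \<open>x\<close>, so its old value is dropped before a
    new one is chosen.\<close>
  let ?D = "D - {x}"
  have D: "finite ?D" "card ?D < t" "x \<notin> ?D"
    using Ex.prems(1,2) card_Diff1_le[of D x] by auto
  have bf: "back_and_forth \<gamma> V W \<delta> U Z ?D v w"
    by (rule back_and_forth_subset[OF Ex.prems(4)]) blast
  have IH: "sat (struc V W) (v(x := a)) \<phi> \<longleftrightarrow> sat (struc U Z) (w(x := b)) \<phi>"
    if "back_and_forth \<gamma> V W \<delta> U Z (insert x ?D) (v(x := a)) (w(x := b))" for a b
  proof (rule Ex.IH[OF _ _ _ that])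
    have "card (insert x ?D) \<le> Suc (card D)"
      using Ex.prems(1) by (simp add: card_insert_if)
    then show "card (insert x ?D) + size \<phi> \<le> t" using Ex.prems(2) by simp
  qed (use Ex.prems(1,3) in auto)
  show ?case
  proof
    assume "sat (struc V W) v (Ex x \<phi>)"
    then obtain a where a: "a \<in> V" "sat (struc V W) (v(x := a)) \<phi>" by auto
    obtain b where "b \<in> U" "back_and_forth \<gamma> V W \<delta> U Z (insert x ?D) (v(x := a)) (w(x := b))"
      using back_and_forth_insert[OF assms(1,2) bf D a(1)] by blast
    then show "sat (struc U Z) w (Ex x \<phi>)" using IH a(2) by auto
  next
    assume "sat (struc U Z) w (Ex x \<phi>)"
    then obtain b where b: "b \<in> U" "sat (struc U Z) (w(x := b)) \<phi>" by auto
    obtain a where a: "a \<in> V" "back_and_forth \<delta> U Z \<gamma> V W (insert x ?D) (w(x := b)) (v(x := a))"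
      using back_and_forth_insert[OF assms(2,1) back_and_forth_sym[OF bf] D b(1)] by blast
    then show "sat (struc V W) v (Ex x \<phi>)" using IH[OF back_and_forth_sym[OF a(2)]] b(2) by auto
  qed
qed

text \<open>The game starts with no variables in use. The only tuple to compare is then the empty
  one, which is in no relation because arities are at least 2.\<close>

lemma sat_sentence_iff:
  assumes "saturated t \<gamma> V W" "saturated t \<delta> U Z" "sentence \<rho> r \<phi>" "size \<phi> \<le> t"
  shows "sat (struc V W) v \<phi> \<longleftrightarrow> sat (struc U Z) w \<phi>"
proof (rule sat_iff_if_back_and_forth[OF assms(1,2)])
  have nil: "[] \<notin> rel (struc V' W') k" if "W' \<subseteq> slots \<gamma>' V'" for \<gamma>' V' W' k
  proof
    assume "[] \<in> rel (struc V' W') k"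
    from rel_struc_subset_rainbow[OF that this] show False
      using two_le_arity[of k] by (simp add: rainbow_def)
  qed
  show "back_and_forth \<gamma> V W \<delta> U Z {} v w"
    unfolding back_and_forth_def
    using nil[OF saturatedD(4)[OF assms(1)]] nil[OF saturatedD(4)[OF assms(2)]]
    by (simp del: rel_struc)
qed (use assms(3,4) in \<open>auto simp: sentence_def\<close>)

section \<open>Almost all structures\<close>

definition good :: "nat \<Rightarrow> nat rel_struct \<Rightarrow> bool" where
  "good t M \<longleftrightarrow> (\<exists>\<gamma> W. saturated t \<gamma> (univ M) W \<and> M = struc (univ M) W)"

text \<open>Taking colourings as extensional functions makes them finite in number. The union is in
  general not disjoint: a structure recurs for each of its colourings.\<close>

lemma S_class_eq:
  assumes "0 < n"
  shows "S_class \<rho> r l I n = (\<Union>\<gamma>\<in>{1..n} \<rightarrow>\<^sub>E {1..l}. coloured_structures \<gamma> {1..n})"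
proof (intro equalityI subsetI)
  fix M assume M: "M \<in> S_class \<rho> r l I n"
  then have L: "L_structure \<rho> r M" "univ M = {1..n}" by (simp_all add: S_class_def)
  obtain \<gamma>0 where \<gamma>0: "strong_colouring l M \<gamma>0"
    using M by (auto simp: S_class_def strongly_colourable_def)
  define \<gamma> where "\<gamma> = restrict \<gamma>0 {1..n}"
  have "\<gamma> \<in> {1..n} \<rightarrow>\<^sub>E {1..l}"
    using \<gamma>0 L(2) unfolding \<gamma>_def strong_colouring_def by (simp add: restrict_PiE_iff Pi_iff)
  moreover have "strong_colouring l M \<gamma>"
    unfolding strong_colouring_def
  proof (intro conjI allI ballI impI)
    show "\<gamma> \<in> univ M \<rightarrow> {1..l}" using calculation L(2) by (simp add: PiE_def)
    fix k a i j assume a: "a \<in> rel M k" "i < length a" "j < length a" "i \<noteq> j"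
    have "set a \<subseteq> univ M" using L(1) a(1) unfolding L_structure_def by blast
    then have "a ! i \<in> {1..n}" "a ! j \<in> {1..n}" using a(2,3) L(2) nth_mem by blast+
    then have "\<gamma> (a ! i) = \<gamma>0 (a ! i)" "\<gamma> (a ! j) = \<gamma>0 (a ! j)" by (simp_all add: \<gamma>_def)
    then show "\<gamma> (a ! i) \<noteq> \<gamma> (a ! j)" using \<gamma>0 a unfolding strong_colouring_def by simp
  qed
  ultimately show "M \<in> (\<Union>\<gamma>\<in>{1..n} \<rightarrow>\<^sub>E {1..l}. coloured_structures \<gamma> {1..n})"
    using M by (auto simp: S_class_def coloured_structures_def)
next
  fix M assume "M \<in> (\<Union>\<gamma>\<in>{1..n} \<rightarrow>\<^sub>E {1..l}. coloured_structures \<gamma> {1..n})"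
  then show "M \<in> S_class \<rho> r l I n"
    by (auto simp: S_class_def coloured_structures_def strongly_colourable_def)
qed

lemma coloured_structures_colouring:
  fixes n :: nat
  assumes "0 < n" "\<gamma> \<in> {1..n} \<rightarrow>\<^sub>E {1..l}"
  shows "coloured_structures \<gamma> {1..n} = struc {1..n} ` Pow (slots \<gamma> {1..n})"
proof (rule coloured_structures_eq_image)
  show "{1..n} \<noteq> {}" using assms(1) by (simp add: Suc_le_eq)
  show "\<gamma> \<in> {1..n} \<rightarrow> {1..l}" using assms(2) by (simp add: PiE_def)
qed

lemma finite_S_class: "finite (S_class \<rho> r l I n)"
proof (cases "n = 0")
  case True
  then have "S_class \<rho> r l I n = {}" by (auto simp: S_class_def L_structure_def)
  then show ?thesis by simp
next
  case False
  then have n: "0 < n" by simp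
  show ?thesis
    unfolding S_class_eq[OF n]
  proof (rule finite_UN_I[OF finite_colourings])
    fix \<gamma> assume "\<gamma> \<in> {1..n} \<rightarrow>\<^sub>E {1..l}"
    then show "finite (coloured_structures \<gamma> {1..n})"
      using coloured_structures_colouring[OF n] by (simp add: finite_slots)
  qed simp
qed

lemma saturatedI:
  assumes "\<gamma> \<in> {1..n} \<rightarrow>\<^sub>E {1..l}" "W \<subseteq> slots \<gamma> {1..n}" "ext t \<gamma> {1..n} W"
  shows "saturated t \<gamma> {1..n} W"
  using assms by (simp add: saturated_def PiE_def)

text \<open>A structure that is not good still has a colouring, and the extension property fails for
  it; so such structures are at most as many as the failing pairs.\<close>

lemma card_not_good_le:
  assumes n: "0 < n"
  shows "real (card {M \<in> S_class \<rho> r l I n. \<not> good t M}) \<le> error t n * weight {1..n}"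
proof -
  let ?V = "{1..n}"
  let ?G = "?V \<rightarrow>\<^sub>E {1..l}" and ?B = "\<lambda>\<gamma>. {W \<in> Pow (slots \<gamma> ?V). \<not> ext t \<gamma> ?V W}"
  have fin: "finite (?B \<gamma>)" for \<gamma> by (simp add: finite_slots)
  have "{M \<in> S_class \<rho> r l I n. \<not> good t M} \<subseteq> (\<Union>\<gamma>\<in>?G. struc ?V ` ?B \<gamma>)"
  proof
    fix M assume "M \<in> {M \<in> S_class \<rho> r l I n. \<not> good t M}"
    then have M: "M \<in> S_class \<rho> r l I n" "\<not> good t M" by simp_all
    then obtain \<gamma> where \<gamma>: "\<gamma> \<in> ?G" "M \<in> coloured_structures \<gamma> ?V"
      unfolding S_class_eq[OF n] by blast
    then obtain W where W: "W \<in> Pow (slots \<gamma> ?V)" "M = struc ?V W"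
      unfolding coloured_structures_colouring[OF n \<gamma>(1)] by blast
    have "\<not> ext t \<gamma> ?V W"
    proof
      assume "ext t \<gamma> ?V W"
      then have "saturated t \<gamma> ?V W" using W(1) by (intro saturatedI[OF \<gamma>(1)]) simp_all
      then have "good t M" unfolding good_def W(2) univ_struc by blast
      then show False using M(2) by simp
    qed
    then have "M \<in> struc ?V ` ?B \<gamma>" using W by blast
    then show "M \<in> (\<Union>\<gamma>\<in>?G. struc ?V ` ?B \<gamma>)" using \<gamma>(1) by blast
  qed
  then have "card {M \<in> S_class \<rho> r l I n. \<not> good t M} \<le> card (\<Union>\<gamma>\<in>?G. struc ?V ` ?B \<gamma>)"
    by (intro card_mono finite_UN_I finite_colourings finite_imageI fin) simp_all
  also have "\<dots> \<le> (\<Sum>\<gamma>\<in>?G. card (struc ?V ` ?B \<gamma>))"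
    by (intro card_UN_le finite_colourings) simp
  also have "\<dots> \<le> (\<Sum>\<gamma>\<in>?G. card (?B \<gamma>))" by (intro sum_mono card_image_le fin)
  finally have "real (card {M \<in> S_class \<rho> r l I n. \<not> good t M}) \<le> real (\<Sum>\<gamma>\<in>?G. card (?B \<gamma>))"
    by (rule of_nat_mono)
  also have "\<dots> = (\<Sum>\<gamma>\<in>?G. real (card (?B \<gamma>)))" by (rule of_nat_sum)
  also have "\<dots> \<le> error t (card ?V) * weight ?V" by (rule sum_not_ext_le) simp_all
  finally show ?thesis by simp
qed

text \<open>The left side bounds from below the number of pairs with the extension property; the
  factor \<open>l ^ l\<close> on the right accounts for the repeated counting of a good
  structure.\<close>

lemma card_good_ge:
  assumes n: "0 < n" and t: "l < t"
  shows "(1 - error t n) * weight {1..n} \<le> real l ^ l * real (card {M \<in> S_class \<rho> r l I n. good t M})"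
proof -
  let ?V = "{1..n}"
  let ?G = "?V \<rightarrow>\<^sub>E {1..l}" and ?F = "{1..l} \<rightarrow>\<^sub>E {1..l}"
  let ?A = "\<lambda>\<gamma>. {W \<in> Pow (slots \<gamma> ?V). ext t \<gamma> ?V W}"
  let ?B = "\<lambda>\<gamma>. {W \<in> Pow (slots \<gamma> ?V). \<not> ext t \<gamma> ?V W}"
  let ?good = "{M \<in> S_class \<rho> r l I n. good t M}"
  define P where "P = Sigma ?G (\<lambda>\<gamma>. struc ?V ` ?A \<gamma>)"
  \<comment> \<open>A reference colouring depending on \<open>M\<close> alone, so that any other
    colouring of \<open>M\<close> is given by a map of the colours.\<close>
  define c where "c = (\<lambda>M. SOME \<gamma>. \<exists>W. saturated t \<gamma> (univ M) W \<and> M = struc (univ M) W)"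
  have c: "\<exists>W. saturated t (c M) (univ M) W \<and> M = struc (univ M) W" if "good t M" for M
    using that unfolding good_def c_def by (rule someI_ex)
  \<comment> \<open>A good structure has at most \<open>l ^ l\<close> strong colourings, since each one is a function of
    a fixed one among them.\<close>
  define \<Psi> where "\<Psi> = (\<lambda>(M, p :: nat \<Rightarrow> nat). (restrict (\<lambda>x. p (c M x)) ?V, M))"
  have "P \<subseteq> \<Psi> ` (?good \<times> ?F)"
  proof
    fix z assume "z \<in> P"
    then obtain \<gamma> W where z: "z = (\<gamma>, struc ?V W)" and \<gamma>: "\<gamma> \<in> ?G" and W: "W \<subseteq> slots \<gamma> ?V" "ext t \<gamma> ?V W"
      unfolding P_def by blast
    let ?M = "struc ?V W"
    have sat: "saturated t \<gamma> ?V W" by (rule saturatedI[OF \<gamma> W])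
    then have good: "good t ?M" unfolding good_def univ_struc by blast
    have "?M \<in> coloured_structures \<gamma> ?V"
      unfolding coloured_structures_colouring[OF n \<gamma>] using W(1) by blast
    then have M: "?M \<in> ?good" using good \<gamma> unfolding S_class_eq[OF n] by blast
    obtain W' where W': "saturated t (c ?M) ?V W'" "?M = struc ?V W'"
      using c[OF good] unfolding univ_struc by blast
    have "strong_colouring l ?M \<gamma>" by (rule saturated_colouring[OF sat]) (use n in simp)
    then have same: "\<gamma> x = \<gamma> y" if "x \<in> ?V" "y \<in> ?V" "c ?M x = c ?M y" for x y
      using saturated_unique[OF W'(1) t that(1,2)] that(3) unfolding W'(2)[symmetric] by blast
    \<comment> \<open>The new colour is read off at a representative of the class; the value
      \<open>1\<close> merely keeps \<open>p\<close> inside \<open>{1..l}\<close> at colours outside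
      the range of \<open>c\<close>.\<close>
    define p where "p = restrict (\<lambda>i. if i \<in> c ?M ` ?V then \<gamma> (inv_into ?V (c ?M) i) else 1) {1..l}"
    have "\<gamma> (inv_into ?V (c ?M) i) \<in> {1..l}" if "i \<in> c ?M ` ?V" for i
      using \<gamma> inv_into_into[OF that] by (rule PiE_mem)
    then have "p \<in> ?F" using two_le_l unfolding p_def by (auto simp: restrict_PiE_iff)
    moreover have "restrict (\<lambda>x. p (c ?M x)) ?V = \<gamma>"
    proof
      fix x
      show "restrict (\<lambda>x. p (c ?M x)) ?V x = \<gamma> x"
      proof (cases "x \<in> ?V")
        case True
        then have i: "c ?M x \<in> c ?M ` ?V" by (rule imageI)
        have "c ?M x \<in> {1..l}" using saturatedD(3)[OF W'(1)] True by (rule funcset_mem)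
        then have "p (c ?M x) = \<gamma> (inv_into ?V (c ?M) (c ?M x))" using i by (simp add: p_def)
        also have "\<dots> = \<gamma> x" by (rule same[OF inv_into_into[OF i] True f_inv_into_f[OF i]])
        finally show ?thesis using True by simp
      next
        case False
        then show ?thesis by (simp only: restrict_def if_False PiE_arb[OF \<gamma> False])
      qed
    qed
    ultimately show "z \<in> \<Psi> ` (?good \<times> ?F)"
      using M unfolding z by (intro image_eqI[of _ _ "(?M, p)"]) (simp_all add: \<Psi>_def)
  qed
  then have "card P \<le> card (?good \<times> ?F)"
    by (intro surj_card_le finite_cartesian_product finite_colourings) (simp_all add: finite_S_class)
  also have "\<dots> = card ?good * l ^ l" by (simp add: card_cartesian_product card_PiE)
  finally have P_le: "real (card P) \<le> real (card ?good * l ^ l)" by (rule of_nat_mono)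
  have AB: "real (card (?A \<gamma>)) = 2 ^ card (slots \<gamma> ?V) - real (card (?B \<gamma>))" for \<gamma>
  proof -
    have "card (Pow (slots \<gamma> ?V)) = card (?A \<gamma> \<union> ?B \<gamma>)" by (rule arg_cong[of _ _ card]) blast
    also have "\<dots> = card (?A \<gamma>) + card (?B \<gamma>)"
      by (rule card_Un_disjoint) (auto simp: finite_slots)
    finally have "2 ^ card (slots \<gamma> ?V) = card (?A \<gamma>) + card (?B \<gamma>)"
      by (simp only: card_Pow finite_slots finite_atLeastAtMost)
    then have "real (2 ^ card (slots \<gamma> ?V)) = real (card (?A \<gamma>) + card (?B \<gamma>))" by (rule arg_cong)
    then show ?thesis by simp
  qed
  have "card P = (\<Sum>\<gamma>\<in>?G. card (struc ?V ` ?A \<gamma>))"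
    unfolding P_def by (intro card_SigmaI finite_colourings) (simp_all add: finite_slots)
  also have "\<dots> = (\<Sum>\<gamma>\<in>?G. card (?A \<gamma>))"
    by (intro sum.cong refl card_image inj_on_subset[OF inj_on_struc]) blast
  finally have "real (card P) = (\<Sum>\<gamma>\<in>?G. 2 ^ card (slots \<gamma> ?V)) - (\<Sum>\<gamma>\<in>?G. real (card (?B \<gamma>)))"
    by (simp only: of_nat_sum AB sum_subtractf)
  also have "(\<Sum>\<gamma>\<in>?G. 2 ^ card (slots \<gamma> ?V)) = real (weight ?V)" by (simp add: weight_def)
  finally have "real (card P) \<ge> weight ?V - error t n * weight ?V"
    using sum_not_ext_le[of ?V t] by simp
  then show ?thesis using P_le by (simp add: algebra_simps)
qed

text \<open>\<open>weight\<close> cancels from the two preceding estimates: the ratio of the other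
  structures to the good ones is at most \<open>l ^ l * error t n / (1 - error t n)\<close>.\<close>

lemma almost_all_good:
  assumes t: "l < t"
  shows "almost_all (S_class \<rho> r l I) (good t)"
  unfolding almost_all_def
proof (rule tendsto_sandwich)
  let ?S = "S_class \<rho> r l I" and ?K = "real l ^ l" and ?e = "error t"
  have e: "?e \<longlonglongrightarrow> 0" using t by (intro error_tendsto_0) simp
  have "(\<lambda>n. 1 - ?K * ?e n / (1 - ?e n)) \<longlonglongrightarrow> 1 - ?K * 0 / (1 - 0)"
    by (intro tendsto_intros e) simp
  then show "(\<lambda>n. 1 - ?K * ?e n / (1 - ?e n)) \<longlonglongrightarrow> 1" by simp
  show "\<forall>\<^sub>F n in sequentially. 1 - ?K * ?e n / (1 - ?e n)
      \<le> real (card {M \<in> ?S n. good t M}) / real (card (?S n))"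
    using eventually_gt_at_top[of 0] order_tendstoD(2)[OF e zero_less_one]
  proof eventually_elim
    case (elim n)
    define g b w where "g = real (card {M \<in> ?S n. good t M})"
      and "b = real (card {M \<in> ?S n. \<not> good t M})" and "w = real (weight {1..n})"
    have K: "0 < ?K" using two_le_l by simp
    have "0 < l ^ card {1..n}" using two_le_l by simp
    also have "\<dots> \<le> weight {1..n}" by (rule weight_ge) simp
    finally have w: "0 < w" by (simp add: w_def)
    have b: "b \<le> ?e n * w" "0 \<le> b"
      unfolding b_def w_def by (rule card_not_good_le[OF elim(1)]) simp
    have g: "(1 - ?e n) * w \<le> ?K * g"
      unfolding g_def w_def by (rule card_good_ge[OF elim(1) t])
    have "0 < (1 - ?e n) * w" using elim(2) w by simp
    then have g0: "0 < g" using g K by (metis less_le_trans zero_less_mult_pos)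
    have "card (?S n) = card ({M \<in> ?S n. good t M} \<union> {M \<in> ?S n. \<not> good t M})"
      by (rule arg_cong[of _ _ card]) blast
    also have "\<dots> = card {M \<in> ?S n. good t M} + card {M \<in> ?S n. \<not> good t M}"
      by (rule card_Un_disjoint) (auto simp: finite_S_class)
    finally have S: "real (card (?S n)) = g + b" by (simp add: g_def b_def)
    have "b * (1 - ?e n) \<le> ?e n * w * (1 - ?e n)" using b elim(2) by (intro mult_right_mono) simp_all
    also have "\<dots> = ?e n * ((1 - ?e n) * w)" by (simp add: mult_ac)
    also have "\<dots> \<le> ?e n * (?K * g)"
    proof (rule mult_left_mono[OF g])
      have "0 \<le> ?e n * w" using b by linarith
      then show "0 \<le> ?e n" using w by (simp add: zero_le_mult_iff)
    qed
    finally have "b / g \<le> ?K * ?e n / (1 - ?e n)" using g0 elim(2) by (simp add: field_simps)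
    moreover have "b / (g + b) \<le> b / g" using g0 b(2) by (intro divide_left_mono) simp_all
    moreover have "g / (g + b) = 1 - b / (g + b)" using g0 b(2) by (simp add: field_simps)
    ultimately have "1 - ?K * ?e n / (1 - ?e n) \<le> g / (g + b)" by linarith
    then show ?case unfolding S g_def .
  qed
  have "real (card {M \<in> ?S n. good t M}) / real (card (?S n)) \<le> 1" for n
  proof -
    have "card {M \<in> ?S n. good t M} \<le> card (?S n)" by (intro card_mono finite_S_class) auto
    then show ?thesis by (intro divide_le_eq_1[THEN iffD2]) linarith
  qed
  then show "\<forall>\<^sub>F n in sequentially. real (card {M \<in> ?S n. good t M}) / real (card (?S n)) \<le> 1"
    by simp
qed simp

section \<open>Unique colourability, definability and the zero-one law\<close>

lemma good_unique:
  assumes t: "l < t" and "good t M" "strong_colouring l M \<delta>" "strong_colouring l M \<delta>'"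
    and ab: "a \<in> univ M" "b \<in> univ M"
  shows "\<delta> a = \<delta> b \<longleftrightarrow> \<delta>' a = \<delta>' b"
proof -
  obtain \<gamma> W where W: "saturated t \<gamma> (univ M) W" "M = struc (univ M) W"
    using assms(2) by (auto simp: good_def)
  have "\<epsilon> a = \<epsilon> b \<longleftrightarrow> \<gamma> a = \<gamma> b" if "strong_colouring l M \<epsilon>" for \<epsilon>
    using that W(2) by (intro saturated_unique[OF W(1) t ab]) metis
  then show ?thesis using assms(3,4) by blast
qed

lemma good_clique_iff:
  assumes t: "l < t" and "good t M" and \<delta>: "strong_colouring l M \<delta>"
    and ab: "a \<in> univ M" "b \<in> univ M"
  shows "\<delta> a = \<delta> b \<longleftrightarrow> (\<exists>g. clique M g \<and> g 0 = a \<and> g 1 = b)"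
proof
  obtain \<gamma> W where W: "saturated t \<gamma> (univ M) W" "M = struc (univ M) W"
    using assms(2) by (auto simp: good_def)
  assume "\<delta> a = \<delta> b"
  moreover have "\<delta> a = \<delta> b \<longleftrightarrow> \<gamma> a = \<gamma> b"
    using \<delta> W(2) by (intro saturated_unique[OF W(1) t ab]) metis
  ultimately obtain g where "clique (struc (univ M) W) g" "g 0 = a" "g 1 = b"
    using clique_exists[OF W(1) t ab] by blast
  then show "\<exists>g. clique M g \<and> g 0 = a \<and> g 1 = b" using W(2) by metis
next
  assume "\<exists>g. clique M g \<and> g 0 = a \<and> g 1 = b"
  then show "\<delta> a = \<delta> b" using clique_colours_eq[OF \<delta>] by blast
qed

lemma good_colourable:
  assumes "good t M" "univ M \<noteq> {}"
  shows "strongly_colourable l M"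
proof -
  obtain \<gamma> W where W: "saturated t \<gamma> (univ M) W" "M = struc (univ M) W"
    using assms(1) by (auto simp: good_def)
  have "strong_colouring l (struc (univ M) W) \<gamma>" by (rule saturated_colouring[OF W(1) assms(2)])
  then show ?thesis unfolding strongly_colourable_def W(2)[symmetric] by blast
qed

lemma univ_S_class: "0 < n \<Longrightarrow> M \<in> S_class \<rho> r l I n \<Longrightarrow> univ M \<noteq> {}"
  by (auto simp: S_class_def)

lemma almost_all_uniquely_colourable:
  "almost_all (S_class \<rho> r l I) (uniquely_strongly_colourable l)"
proof (rule almost_all_mono[OF almost_all_good[of "Suc l"] finite_S_class])
  fix n M assume M: "0 < n" "M \<in> S_class \<rho> r l I n" "good (Suc l) M"
  show "uniquely_strongly_colourable l M"
    unfolding uniquely_strongly_colourable_def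
    using good_colourable[OF M(3) univ_S_class[OF M(1,2)]] good_unique[OF lessI M(3)] by blast
qed simp

lemma definable_colouring:
  "\<exists>\<xi>. formula \<rho> r \<xi> \<and> free_vars \<xi> \<subseteq> {0, 1} \<and>
     almost_all (S_class \<rho> r l I) (\<lambda>M. \<forall>\<gamma>. strong_colouring l M \<gamma> \<longrightarrow>
       (\<forall>a\<in>univ M. \<forall>b\<in>univ M. \<gamma> a = \<gamma> b \<longleftrightarrow> models_at M \<xi> a b))"
proof -
  obtain \<xi> where \<xi>: "formula \<rho> r \<xi>" "free_vars \<xi> \<subseteq> {0, 1}"
    "\<And>(M :: nat rel_struct) a b. a \<in> univ M \<Longrightarrow> b \<in> univ M \<Longrightarrow>
       models_at M \<xi> a b \<longleftrightarrow> (\<exists>g. clique M g \<and> g 0 = a \<and> g 1 = b)"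
    using clique_formula[where 'a = nat] by blast
  have "almost_all (S_class \<rho> r l I) (\<lambda>M. \<forall>\<gamma>. strong_colouring l M \<gamma> \<longrightarrow>
       (\<forall>a\<in>univ M. \<forall>b\<in>univ M. \<gamma> a = \<gamma> b \<longleftrightarrow> models_at M \<xi> a b))"
  proof (rule almost_all_mono[OF almost_all_good[of "Suc l"] finite_S_class])
    fix M assume M: "good (Suc l) M"
    show "\<forall>\<gamma>. strong_colouring l M \<gamma> \<longrightarrow>
       (\<forall>a\<in>univ M. \<forall>b\<in>univ M. \<gamma> a = \<gamma> b \<longleftrightarrow> models_at M \<xi> a b)"
      using good_clique_iff[OF lessI M] \<xi>(3) by simp
  qed simp
  then show ?thesis using \<xi>(1,2) by blast
qed

lemma zero_one_law_S_class: "zero_one_law \<rho> r (S_class \<rho> r l I)"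
  unfolding zero_one_law_def
proof (intro allI impI)
  fix \<phi> assume \<phi>: "sentence \<rho> r \<phi>"
  \<comment> \<open>Larger than \<open>l\<close> for the counting, and at least
    \<open>size \<phi>\<close> for the back-and-forth argument.\<close>
  let ?t = "Suc (l + size \<phi>)"
  have good: "almost_all (S_class \<rho> r l I) (good ?t)" by (rule almost_all_good) simp
  show "almost_all (S_class \<rho> r l I) (\<lambda>M. models M \<phi>) \<or> almost_all (S_class \<rho> r l I) (\<lambda>M. models M (Neg \<phi>))"
  \<comment> \<open>Saturated structures of all sizes agree on \<open>\<phi>\<close>, so the
    existence of a single one satisfying it decides which alternative holds.\<close>
  proof (cases "\<exists>\<gamma> V W v. saturated ?t \<gamma> V W \<and> sat (struc V W) v \<phi>")
    case True
    then obtain \<gamma> V W v where W: "saturated ?t \<gamma> V W" "sat (struc V W) v \<phi>" by blast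
    have "models M \<phi>" if M: "good ?t M" for M
    proof -
      obtain \<delta> Z where Z: "saturated ?t \<delta> (univ M) Z" "M = struc (univ M) Z"
        using M by (auto simp: good_def)
      have "sat (struc (univ M) Z) w \<phi>" for w

        using sat_sentence_iff[OF W(1) Z(1) \<phi>, of v w] W(2) by simp
      then show ?thesis unfolding models_def Z(2)[symmetric] by blast
    qed
    then have "almost_all (S_class \<rho> r l I) (\<lambda>M. models M \<phi>)"
      by (rule almost_all_mono[OF good finite_S_class])
    then show ?thesis by (rule disjI1)
  next
    case False
    have "models M (Neg \<phi>)" if M: "good ?t M" for M
    proof -
      obtain \<delta> Z where Z: "saturated ?t \<delta> (univ M) Z" "M = struc (univ M) Z"
        using M by (auto simp: good_def)
      have "\<not> sat (struc (univ M) Z) w \<phi>" for w using False Z(1) by blast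
      then show ?thesis unfolding models_def sat.simps Z(2)[symmetric] by blast
    qed
    then have "almost_all (S_class \<rho> r l I) (\<lambda>M. models M (Neg \<phi>))"
      by (rule almost_all_mono[OF good finite_S_class])
    then show ?thesis by (rule disjI2)
  qed
qed

end

theorem theorem10p4:
  fixes l \<rho> :: nat and r :: "nat \<Rightarrow> nat" and I :: "nat set"
  assumes "l \<ge> 2" and "\<rho> > 0"
    and "\<forall>k\<in>{1..\<rho>}. r k \<ge> 2"
    and "\<forall>k\<in>{1..\<rho>}. r k \<le> l"
    and "I \<subseteq> {1..\<rho>}"
  shows "(\<exists>\<xi>. formula \<rho> r \<xi> \<and> free_vars \<xi> \<subseteq> {0, 1} \<and>
            almost_all (S_class \<rho> r l I)
              (\<lambda>M. \<forall>\<gamma>. strong_colouring l M \<gamma> \<longrightarrow>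
                 (\<forall>a\<in>univ M. \<forall>b\<in>univ M. \<gamma> a = \<gamma> b \<longleftrightarrow> models_at M \<xi> a b))) \<and>
         almost_all (S_class \<rho> r l I) (uniquely_strongly_colourable l) \<and>
         zero_one_law \<rho> r (S_class \<rho> r l I)"
proof -
  interpret vocabulary \<rho> l r I using assms by unfold_locales simp_all
  show ?thesis
    by (intro conjI definable_colouring almost_all_uniquely_colourable zero_one_law_S_class)
qed

end
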